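(* Let $n\ge 1$, $N:=2^n$, and consider the $n$-qubit bilinear control system $\Sigma_a$ $$\dot\rho(t) = -\big(i\hat H_u(t) + \gamma(t)\,\Gamma_a\big)\rho(t),\qquad \rho(0)=\rho_0,$$ where $H_u(t)=H_0+\sum_{j=1}^m u_j(t)H_j$ with Hermitian $H_0,H_1,\dots,H_m$ on $(\mathbb C^2)^{\otimes n}$, real piecewise-constant (not necessarily bounded) control amplitudes $u_j(t)$, $\hat H(\rho):=[H,\rho]$, and $$\Gamma_a(\rho) := -\Big(V_a\rho V_a^\dagger - \tfrac12\big(V_a^\dagger V_a\rho+\rho V_a^\dagger V_a\big)\Big),\qquad V_a:=\mathbb 1_2^{\otimes(n-1)}\otimes|0\rangle\langle 1|,$$ i.e. amplitude-damping relaxation on the $n$-th qubit, whose noise amplitude is a piecewise-constant control switchable between two values, $\gamma(t)\in\{0,\gamma_*\}$ with a fixed $\gamma_*>0$. Assume there are no further sources of decoherence, and that the Hamiltonian controllability condition $$\langle iH_0, iH_1,\dots,iH_m\rangle_{\mathrm{Lie}} = \mathfrak{su}(N)$$ holds. Then for every density operator $\rho_0\in\mathfrak{pos}_1$, $$\overline{\mathfrak{reach}_{\Sigma_a}(\rho_0)} = \mathfrak{pos}_1,$$ where the closure is understood as the limit $\gamma_*\tau\to\infty$ of the total control duration $\tau$.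
   Context: $\mathfrak{pos}_1$ denotes the set of all density operators (positive semidefinite, trace one) on $(\mathbb C^2)^{\otimes n}$. $\langle\cdot\rangle_{\mathrm{Lie}}$ denotes the Lie algebra generated by the given elements (closure under linear combinations and commutators). The reachable set $\mathfrak{reach}_{\Sigma_a}(\rho_0)$ is the set of all states $\rho(\tau)$, $\tau\ge 0$, obtainable from $\rho_0$ by solutions of the control system for some admissible choice of controls $u_j(t)$ and $\gamma(t)$. Its closure consists of the states reachable asymptotically as $\gamma_*\tau\to\infty$. *)

theory Defs
  imports "HOL-Analysis.Analysis" "Jordan_Normal_Form.Matrix"
begin

text \<open>Square complex matrices of size N are elements of carrier_mat N N.
  Basis ordering of (C^2)^{tensor n}: index k = sum of b_l 2^(n-l), so the n-th qubit
  is the least significant bit.\<close>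

definition adj :: "complex mat \<Rightarrow> complex mat" where
  "adj A = mat (dim_col A) (dim_row A) (\<lambda>(i,j). cnj (A $$ (j,i)))"

definition mtrace :: "complex mat \<Rightarrow> complex" where
  "mtrace A = (\<Sum>i<dim_row A. A $$ (i,i))"

definition hermitian_mat :: "nat \<Rightarrow> complex mat \<Rightarrow> bool" where
  "hermitian_mat N A \<longleftrightarrow> A \<in> carrier_mat N N \<and> adj A = A"

definition pos1 :: "nat \<Rightarrow> complex mat set" where
  "pos1 N = {\<rho>. hermitian_mat N \<rho> \<and>
      (\<forall>v::nat \<Rightarrow> complex. 0 \<le> Re (\<Sum>i<N. \<Sum>j<N. cnj (v i) * \<rho> $$ (i,j) * v j)) \<and>
      mtrace \<rho> = 1}"

definition su :: "nat \<Rightarrow> complex mat set" where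
  "su N = {X \<in> carrier_mat N N. adj X = - X \<and> mtrace X = 0}"

inductive_set lie_gen :: "complex mat set \<Rightarrow> complex mat set" for G where
  gen: "X \<in> G \<Longrightarrow> X \<in> lie_gen G"
| lin: "X \<in> lie_gen G \<Longrightarrow> Y \<in> lie_gen G \<Longrightarrow> (complex_of_real a \<cdot>\<^sub>m X) + Y \<in> lie_gen G"
| comm: "X \<in> lie_gen G \<Longrightarrow> Y \<in> lie_gen G \<Longrightarrow> X * Y - Y * X \<in> lie_gen G"

text \<open>V_a = 1^{tensor (n-1)} tensor |0><1| on N = 2^n dimensional space\<close>
definition V_a :: "nat \<Rightarrow> complex mat" where
  "V_a N = mat N N (\<lambda>(i,j). if odd j \<and> i = j - 1 then 1 else 0)"

definition Gamma_a :: "nat \<Rightarrow> complex mat \<Rightarrow> complex mat" where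
  "Gamma_a N \<rho> = - (V_a N * \<rho> * adj (V_a N)
      - (1/2 :: complex) \<cdot>\<^sub>m (adj (V_a N) * V_a N * \<rho> + \<rho> * (adj (V_a N) * V_a N)))"

definition H_u :: "nat \<Rightarrow> complex mat \<Rightarrow> complex mat list \<Rightarrow> real list \<Rightarrow> complex mat" where
  "H_u N H0 Hs u = mat N N (\<lambda>(i,j). H0 $$ (i,j)
      + (\<Sum>k<length Hs. complex_of_real (u ! k) * (Hs ! k) $$ (i,j)))"

definition gen_L :: "nat \<Rightarrow> complex mat \<Rightarrow> complex mat list \<Rightarrow> real list \<Rightarrow> real
      \<Rightarrow> complex mat \<Rightarrow> complex mat" where
  "gen_L N H0 Hs u g \<rho> = - (\<i> \<cdot>\<^sub>m (H_u N H0 Hs u * \<rho> - \<rho> * H_u N H0 Hs u)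
      + complex_of_real g \<cdot>\<^sub>m Gamma_a N \<rho>)"

definition seg_step :: "nat \<Rightarrow> complex mat \<Rightarrow> complex mat list \<Rightarrow> real
      \<Rightarrow> complex mat \<Rightarrow> complex mat \<Rightarrow> bool" where
  "seg_step N H0 Hs gs \<rho> \<rho>' \<longleftrightarrow>
     (\<exists>u g t (f :: real \<Rightarrow> complex mat). length u = length Hs \<and> g \<in> {0, gs} \<and> t \<ge> 0 \<and>
        f 0 = \<rho> \<and> f t = \<rho>' \<and>
        (\<forall>s\<in>{0..t}. f s \<in> carrier_mat N N \<and>
           (\<forall>i<N. \<forall>j<N. ((\<lambda>r. f r $$ (i,j)) has_vector_derivative
                (gen_L N H0 Hs u g (f s)) $$ (i,j)) (at s within {0..t}))))"

inductive_set reach :: "nat \<Rightarrow> complex mat \<Rightarrow> complex mat list \<Rightarrow> real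
      \<Rightarrow> complex mat \<Rightarrow> complex mat set" for N H0 Hs gs \<rho>0 where
  init: "\<rho>0 \<in> reach N H0 Hs gs \<rho>0"
| step: "\<rho> \<in> reach N H0 Hs gs \<rho>0 \<Longrightarrow> seg_step N H0 Hs gs \<rho> \<rho>'
           \<Longrightarrow> \<rho>' \<in> reach N H0 Hs gs \<rho>0"

text \<open>topological closure within N x N matrices (entrywise metric; all norms equivalent)\<close>
definition mat_closure :: "nat \<Rightarrow> complex mat set \<Rightarrow> complex mat set" where
  "mat_closure N S = {\<rho> \<in> carrier_mat N N. \<forall>\<epsilon>>0. \<exists>\<sigma>\<in>S.
      \<forall>i<N. \<forall>j<N. cmod (\<sigma> $$ (i,j) - \<rho> $$ (i,j)) < \<epsilon>}"

end

theory Submission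
  imports Defs
begin

text \<open>Vectorize the density matrices, so that every piecewise constant control produces an operator
  exponential, and let S be the closure of the semigroup of these flows. The generators whose
  one-parameter semigroups stay in S form a closed convex cone (Trotter), and the lineality space of
  this cone is a Lie algebra. Unitary flows are recurrent, so with \<open>- ad (i H)\<close> the cone contains
  \<open>ad (i H)\<close>; by the controllability condition it contains \<open>ad X\<close> for all \<open>X\<close> in \<open>su N\<close>, and after
  subtracting the drift also the pure damping generator.

  Maximizing the sum of the squared diagonal entries over the compact unitary orbit of a state
  diagonalizes it (Jacobi rotations), and rotations by \<open>pi/2\<close> permute diagonal states. On a diagonal
  state damping moves, in each pair of basis states, the same fraction of weight from the odd to the
  even position. Complete damping merges weights, so every diagonal state can be driven to a basis
  state by induction on the size of the support. Conversely, following the damping backwards from a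
  diagonal state until a weight vanishes yields a preimage with smaller support, so every diagonal
  state is reached from a basis state.\<close>

subsection \<open>One-parameter semigroups in a Banach algebra\<close>

text \<open>The drift \<open>H0\<close> cannot be switched off, so at first only nonnegative
  multiples of operators \<open>- ad (i H)\<close> are available, and the bracket argument, which
  needs both signs, does not apply. Recurrence removes this obstacle: anti-Hermitian generators give
  isometries of the Hilbert-Schmidt norm, their exponentials stay in a compact set, and long waiting
  times approximate negative times. This is why everything is proved for closures and the duration
  is never bounded; the limit of infinite \<open>gs * tau\<close> enters through these waiting times
  and through complete damping. Only the superoperators \<open>ad X\<close> occur, never the group
  SU(N); its compactness is replaced by bounds on finitely many real coordinates. The operators act
  on a space independent of \<open>N\<close>. All generators vanish off the N x N block, so their
  exponentials are the identity there. Positivity cannot be read off the exponential of a damping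
  generator. It comes from the Chernoff product formula, applied to suitably corrected Euler steps;
  the same formula yields Trotter's.\<close>

lemma exp_intertwine:
  fixes X Y B :: "'a::{real_normed_algebra_1,banach}"
  assumes "X * B = B * Y"
  shows "exp X * B = B * exp Y"
proof -
  have pow: "X ^ k * B = B * Y ^ k" for k
  proof (induction k)
    case (Suc k)
    have "X ^ Suc k * B = X * (B * Y ^ k)" by (simp add: mult.assoc Suc)
    also have "\<dots> = B * Y * Y ^ k" by (simp add: mult.assoc[symmetric] assms)
    finally show ?case by (simp add: mult.assoc)
  qed simp
  have "(\<lambda>k. (X ^ k /\<^sub>R fact k) * B) sums (exp X * B)"
    by (rule bounded_linear.sums[OF bounded_linear_mult_left exp_converges])
  moreover have "(\<lambda>k. B * (Y ^ k /\<^sub>R fact k)) sums (B * exp Y)"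
    by (rule bounded_linear.sums[OF bounded_linear_mult_right exp_converges])
  ultimately show ?thesis
    using sums_unique2 by (fastforce simp: pow)
qed

lemma exp_nat_scaleR:
  fixes X :: "'a::{real_normed_algebra_1,banach}"
  shows "exp (real k *\<^sub>R X) = exp X ^ k"
proof (induction k)
  case (Suc k)
  have "exp (real (Suc k) *\<^sub>R X) = exp (X + real k *\<^sub>R X)" by (simp add: algebra_simps)
  also have "\<dots> = exp X * exp (real k *\<^sub>R X)" by (rule exp_add_commuting) simp
  finally show ?case by (simp add: Suc)
qed simp

lemma exp_scaleR_add:
  fixes X :: "'a::{real_normed_algebra_1,banach}"
  shows "exp ((s + t) *\<^sub>R X) = exp (s *\<^sub>R X) * exp (t *\<^sub>R X)"
  by (simp add: scaleR_add_left exp_add_commuting)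

lemma exp_scaleR_minus [simp]:
  fixes X :: "'a::{real_normed_algebra_1,banach}"
  shows "exp (s *\<^sub>R X) * exp (- (s *\<^sub>R X)) = 1" "exp (- (s *\<^sub>R X)) * exp (s *\<^sub>R X) = 1"
  using exp_minus_inverse[of "s *\<^sub>R X"] exp_minus_inverse[of "- (s *\<^sub>R X)"] by auto

text \<open>Telescoping: one factor is exchanged at a time. The bound \<open>1 \<le> c\<close>
  allows the natural exponent k - 1 to be rounded up to k.\<close>

lemma norm_power_diff_le:
  fixes X Y :: "'a::real_normed_algebra_1"
  assumes X: "norm X \<le> c" and Y: "norm Y \<le> c" and c: "1 \<le> c"
  shows "norm (X ^ k - Y ^ k) \<le> real k * c ^ k * norm (X - Y)"
proof (induction k)
  case (Suc k)
  have "X ^ Suc k - Y ^ Suc k = X * (X ^ k - Y ^ k) + (X - Y) * Y ^ k"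
    by (simp add: algebra_simps)
  also have "norm \<dots> \<le> norm X * norm (X ^ k - Y ^ k) + norm (X - Y) * norm (Y ^ k)"
    by (intro norm_triangle_le add_mono norm_mult_ineq)
  also have "\<dots> \<le> c * (real k * c ^ k * norm (X - Y)) + norm (X - Y) * c ^ k"
    using c Y by (intro add_mono mult_mono X Suc order_refl order.trans[OF norm_power_ineq] power_mono) auto
  also have "\<dots> \<le> c * (real k * c ^ k * norm (X - Y)) + c * (norm (X - Y) * c ^ k)"
    using c mult_right_mono[OF c, of "norm (X - Y) * c ^ k"] by simp
  also have "\<dots> = real (Suc k) * c ^ Suc k * norm (X - Y)"
    by (simp add: algebra_simps)
  finally show ?case .
qed simp

lemma right_derivative_bound:
  assumes "(f has_vector_derivative D) (at 0 within {0..})" "0 < e"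
  shows "\<exists>d>0. \<forall>h. 0 \<le> h \<and> h < d \<longrightarrow> norm (f h - f 0 - h *\<^sub>R D) \<le> e * h"
proof -
  have "\<forall>e>0. \<exists>d>0. \<forall>y\<in>{0..}. norm (y - 0) < d \<longrightarrow>
      norm (f y - f 0 - (y - 0) *\<^sub>R D) \<le> e * norm (y - 0)"
    using assms(1) unfolding has_vector_derivative_def has_derivative_within_alt by (rule conjunct2)
  from this[rule_format, OF assms(2)] obtain d where "d > 0" and
    d: "\<forall>y\<in>{0..}. norm (y - 0) < d \<longrightarrow> norm (f y - f 0 - (y - 0) *\<^sub>R D) \<le> e * norm (y - 0)"
    by blast
  show ?thesis
  proof (intro exI conjI allI impI)
    fix h assume "0 \<le> h \<and> h < d"
    then show "norm (f h - f 0 - h *\<^sub>R D) \<le> e * h" using d[rule_format, of h] by simp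
  qed (rule \<open>d > 0\<close>)
qed

text \<open>Chernoff's product formula. \<open>F h\<close> and \<open>exp (h L)\<close> agree up to
  o(h), both are bounded by \<open>exp (c h)\<close>, and so their k-th powers at h = t / k differ
  by at most k * exp (c t) * o(t / k), which tends to 0. Only a right derivative is required, since
  the semigroups of interest exist for nonnegative times.\<close>

lemma chernoff_limit:
  fixes F :: "real \<Rightarrow> 'a::{real_normed_algebra_1,banach}"
  assumes F0: "F 0 = 1"
    and dF: "(F has_vector_derivative L) (at 0 within {0..})"
    and t: "0 \<le> t"
  shows "(\<lambda>k. F (t / real k) ^ k) \<longlonglongrightarrow> exp (t *\<^sub>R L)"
proof (cases "t = 0")
  case True
  then show ?thesis by (simp add: F0)
next
  case False
  with t have t: "0 < t" by simp
  define G where "G h = exp (h *\<^sub>R L)" for h :: real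
  \<comment> \<open>The summand 1 absorbs the first-order remainder of \<open>F\<close>, which is at
    most h near 0.\<close>
  define c where "c = norm L + 1"
  have dG: "(G has_vector_derivative L) (at 0 within {0..})"
    unfolding G_def using exp_scaleR_has_vector_derivative_right[of L 0 "{0..}"] by simp
  have dD: "((\<lambda>h. F h - G h) has_vector_derivative 0) (at 0 within {0..})"
    using has_vector_derivative_diff[OF dF dG] by simp
  have D: "\<exists>d>0. \<forall>h. 0 \<le> h \<and> h < d \<longrightarrow> norm (F h - G h) \<le> e * h" if "e > 0" for e
    using right_derivative_bound[OF dD that] by (simp add: F0 G_def)
  obtain d0 where d0: "d0 > 0" "\<And>h. 0 \<le> h \<Longrightarrow> h < d0 \<Longrightarrow> norm (F h - 1 - h *\<^sub>R L) \<le> h"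
    using right_derivative_bound[OF dF, of 1] by (auto simp: F0)
  have nF: "norm (F h) \<le> exp (c * h)" if "0 \<le> h" "h < d0" for h
  proof -
    have "norm (F h) = norm ((F h - 1 - h *\<^sub>R L) + 1 + h *\<^sub>R L)" by simp
    also have "\<dots> \<le> norm (F h - 1 - h *\<^sub>R L) + norm (1::'a) + norm (h *\<^sub>R L)"
      by (intro norm_triangle_le add_mono order_refl norm_triangle_ineq)
    also have "\<dots> \<le> h + 1 + h * norm L" using d0(2)[OF that] that by simp
    also have "\<dots> = 1 + c * h" by (simp add: c_def algebra_simps)
    also have "\<dots> \<le> exp (c * h)" by (rule exp_ge_add_one_self)
    finally show ?thesis .
  qed
  have nG: "norm (G h) \<le> exp (c * h)" if "0 \<le> h" for h
  proof -
    have "norm (G h) \<le> exp (norm (h *\<^sub>R L))" unfolding G_def by (rule norm_exp)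
    also have "\<dots> \<le> exp (c * h)" using that by (simp add: c_def algebra_simps)
    finally show ?thesis .
  qed
  have Gk: "G (t / real k) ^ k = exp (t *\<^sub>R L)" if "k > 0" for k
    using that by (simp add: G_def exp_nat_scaleR[symmetric])
  have "(\<lambda>k. F (t / real k) ^ k - exp (t *\<^sub>R L)) \<longlonglongrightarrow> 0"
  proof (rule LIMSEQ_I)
    fix r :: real assume r: "0 < r"
    \<comment> \<open>Chosen so that k * exp (c t) * (e * t / k) is exactly r / 2.\<close>
    define e where "e = r / (2 * t * exp (c * t))"
    have e: "e > 0" using r t by (simp add: e_def)
    from D[OF e] obtain d where d: "d > 0" "\<And>h. 0 \<le> h \<Longrightarrow> h < d \<Longrightarrow> norm (F h - G h) \<le> e * h"
      by blast
    obtain K :: nat where K: "t / min d d0 < real K" using reals_Archimedean2 by blast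
    have Kpos: "K > 0"
    proof -
      have "0 < t / min d d0" using t d d0 by simp
      then have "0 < real K" using K by linarith
      then show ?thesis by simp
    qed
    show "\<exists>no. \<forall>n\<ge>no. norm (F (t / real n) ^ n - exp (t *\<^sub>R L) - 0) < r"
    proof (intro exI allI impI)
      fix k assume "K \<le> k"
      then have k: "k > 0" "real K \<le> real k" using Kpos by auto
      define h where "h = t / real k"
      have h0: "0 \<le> h" using t by (simp add: h_def)
      have "t / min d d0 < real k" using K k by linarith
      then have "t < real k * min d d0" using d d0 by (simp add: pos_divide_less_eq)
      then have h1: "h < min d d0"
        unfolding h_def using k by (subst pos_divide_less_eq) (simp_all only: of_nat_0_less_iff mult.commute)
      have "norm (F h ^ k - G h ^ k) \<le> real k * exp (c * h) ^ k * norm (F h - G h)"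
        using h0 h1 by (intro norm_power_diff_le nF nG) (auto simp: c_def)
      also have "\<dots> \<le> real k * exp (c * h) ^ k * (e * h)"
        using h0 h1 by (intro mult_left_mono d) auto
      also have "exp (c * h) ^ k = exp (c * t)"
        using k by (simp add: exp_of_nat_mult[symmetric] h_def)
      also have "real k * exp (c * t) * (e * h) = r / 2"
        using k t by (simp add: e_def h_def)
      also have "\<dots> < r" using r by simp
      finally show "norm (F (t / real k) ^ k - exp (t *\<^sub>R L) - 0) < r"
        using Gk[OF k(1)] by (simp add: h_def)
    qed
  qed
  then show ?thesis by (rule LIM_zero_cancel)
qed

lemma trotter_limit:
  fixes X Y :: "'a::{real_normed_algebra_1,banach}"
  assumes "0 \<le> t"
  shows "(\<lambda>k. (exp ((t / real k) *\<^sub>R X) * exp ((t / real k) *\<^sub>R Y)) ^ k) \<longlonglongrightarrow> exp (t *\<^sub>R (X + Y))"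
proof (rule chernoff_limit[where F = "\<lambda>h. exp (h *\<^sub>R X) * exp (h *\<^sub>R Y)"])
  show "((\<lambda>h. exp (h *\<^sub>R X) * exp (h *\<^sub>R Y)) has_vector_derivative X + Y) (at 0 within {0..})"
    using has_vector_derivative_mult[OF exp_scaleR_has_vector_derivative_right[of X 0 "{0..}"]
        exp_scaleR_has_vector_derivative_right[of Y 0 "{0..}"]]
    by (simp add: add.commute)
qed (use assms in auto)

text \<open>\<open>exp (- s Z) * G s\<close> has derivative 0, hence keeps its value 1 from s =
  0.\<close>

lemma exp_scaleR_unique:
  fixes G :: "real \<Rightarrow> 'a::{real_normed_algebra_1,banach}"
  assumes dG: "\<And>s. (G has_vector_derivative Z * G s) (at s)" and G0: "G 0 = 1"
  shows "G t = exp (t *\<^sub>R Z)"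
proof -
  define h where "h s = exp (s *\<^sub>R (- Z)) * G s" for s
  have "(h has_vector_derivative 0) (at s)" for s
    using has_vector_derivative_mult[OF exp_scaleR_has_vector_derivative_right[of "- Z" s UNIV] dG[of s]]
    by (simp add: h_def[abs_def] mult.assoc)
  then obtain c where "\<And>x. x \<in> UNIV \<Longrightarrow> h x = c"
    using has_vector_derivative_zero_constant[of UNIV h] by auto
  then have "h t = h 0" by simp
  then have "exp (t *\<^sub>R Z) * (exp (- (t *\<^sub>R Z)) * G t) = exp (t *\<^sub>R Z)" by (simp add: h_def G0)
  then show ?thesis by (simp add: mult.assoc[symmetric])
qed

text \<open>Rodrigues' formula: the cubic relation closes the span of 1, Z and Z * Z under
  multiplication by Z, and the right-hand side solves the defining differential equation there. It
  makes the exponentials of plane rotations explicit.\<close>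

lemma exp_scaleR_rotation:
  fixes Z :: "'a::{real_normed_algebra_1,banach}"
  assumes Z: "Z * Z * Z = - Z"
  shows "exp (t *\<^sub>R Z) = 1 + sin t *\<^sub>R Z + (1 - cos t) *\<^sub>R (Z * Z)"
proof -
  define G where "G s = 1 + sin s *\<^sub>R Z + (1 - cos s) *\<^sub>R (Z * Z)" for s
  have dG: "(G has_vector_derivative cos s *\<^sub>R Z + sin s *\<^sub>R (Z * Z)) (at s)" for s
    unfolding G_def by (auto intro!: derivative_eq_intros)
  have ZG: "Z * G s = cos s *\<^sub>R Z + sin s *\<^sub>R (Z * Z)" for s
    using Z by (simp add: G_def distrib_left mult.assoc algebra_simps)
  have "G t = exp (t *\<^sub>R Z)"
    by (rule exp_scaleR_unique) (simp_all only: ZG dG, simp add: G_def)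
  then show ?thesis by (simp add: G_def)
qed

text \<open>The exponential series converges uniformly on a ball around 0 that contains l, by
  comparison with the real series for \<open>exp C\<close>, so its sum is continuous at l.\<close>

lemma tendsto_exp_banach:
  fixes f :: "'b \<Rightarrow> 'a::{real_normed_algebra_1,banach}"
  assumes "(f \<longlongrightarrow> l) F"
  shows "((\<lambda>x. exp (f x)) \<longlongrightarrow> exp l) F"
proof -
  define C where "C = norm l + 1"
  have "uniform_limit (ball 0 C) (\<lambda>n x::'a. \<Sum>i<n. x ^ i /\<^sub>R fact i) (\<lambda>x. \<Sum>i. x ^ i /\<^sub>R fact i) sequentially"
  proof (rule Weierstrass_m_test)
    show "norm (x ^ i /\<^sub>R fact i) \<le> C ^ i /\<^sub>R fact i" if "x \<in> ball 0 C" for i and x :: 'a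
      using that by (auto simp: divide_simps intro!: order.trans[OF norm_power_ineq] power_mono)
    show "summable (\<lambda>i. C ^ i /\<^sub>R fact i)" by (rule summable_exp_generic)
  qed
  then have "continuous_on (ball 0 C) (\<lambda>x::'a. \<Sum>i. x ^ i /\<^sub>R fact i)"
    by (rule uniform_limit_theorem[rotated]) (auto intro!: always_eventually continuous_intros)
  then have "isCont (exp :: 'a \<Rightarrow> 'a) l"
    unfolding exp_def by (rule continuous_on_interior) (simp add: C_def)
  then show ?thesis using assms by (rule isCont_tendsto_compose)
qed

lemma has_vector_derivative_at_quotient:
  "(f has_vector_derivative D) (at x) \<longleftrightarrow> ((\<lambda>h. (1 / h) *\<^sub>R (f (x + h) - f x)) \<longlongrightarrow> D) (at 0)"
  unfolding has_vector_derivative_def has_derivative_at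
proof -
  have "norm (f (x + h) - f x - h *\<^sub>R D) / norm h = norm ((1 / h) *\<^sub>R (f (x + h) - f x) - D)" if "h \<noteq> 0" for h
  proof -
    have "(1 / h) *\<^sub>R (f (x + h) - f x) - D = (1 / h) *\<^sub>R (f (x + h) - f x - h *\<^sub>R D)"
      using that by (simp add: algebra_simps)
    then show ?thesis by simp
  qed
  then have "(\<lambda>h. norm (f (x + h) - f x - h *\<^sub>R D) / norm h) \<midarrow>0\<rightarrow> 0 \<longleftrightarrow>
      (\<lambda>h. norm ((1 / h) *\<^sub>R (f (x + h) - f x) - D)) \<midarrow>0\<rightarrow> 0"
    by (intro filterlim_cong) (auto simp: eventually_at_filter)
  also have "\<dots> \<longleftrightarrow> ((\<lambda>h. (1 / h) *\<^sub>R (f (x + h) - f x)) \<longlongrightarrow> D) (at 0)"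
    by (simp add: tendsto_norm_zero_iff LIM_zero_iff)
  finally show "(bounded_linear (\<lambda>h. h *\<^sub>R D) \<and> (\<lambda>h. norm (f (x + h) - f x - h *\<^sub>R D) / norm h) \<midarrow>0\<rightarrow> 0) \<longleftrightarrow>
      ((\<lambda>h. (1 / h) *\<^sub>R (f (x + h) - f x)) \<longlongrightarrow> D) (at 0)"
    by (simp add: bounded_linear_scaleR_left)
qed

subsection \<open>The Lie wedge of a closed semigroup\<close>

definition wedge :: "'a::{real_normed_algebra_1,banach} set \<Rightarrow> 'a set" where
  "wedge S = {X. \<forall>t\<ge>0. exp (t *\<^sub>R X) \<in> S}"

locale closed_semigroup =
  fixes S :: "'a::{real_normed_algebra_1,banach} set"
  assumes closed: "closed S" and one: "1 \<in> S" and mult: "\<And>a b. a \<in> S \<Longrightarrow> b \<in> S \<Longrightarrow> a * b \<in> S"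
begin

lemma power_mem: "a \<in> S \<Longrightarrow> a ^ k \<in> S"
  by (induction k) (auto intro: one mult)

lemma wedge_scaleR: "X \<in> wedge S \<Longrightarrow> 0 \<le> c \<Longrightarrow> c *\<^sub>R X \<in> wedge S"
  by (auto simp: wedge_def)

text \<open>The powers in Trotter's formula are products of members of \<open>S\<close>, and
  \<open>S\<close> contains their limit.\<close>

lemma wedge_add:
  assumes "X \<in> wedge S" "Y \<in> wedge S"
  shows "X + Y \<in> wedge S"
  unfolding wedge_def
proof (intro CollectI allI impI)
  fix t :: real assume t: "0 \<le> t"
  show "exp (t *\<^sub>R (X + Y)) \<in> S"
    using assms t
    by (intro closed_sequentially[OF closed _ trotter_limit[OF t]] power_mem mult) (auto simp: wedge_def)
qed

lemma wedge_lim: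
  assumes "\<And>k. X k \<in> wedge S" "X \<longlonglongrightarrow> Y"
  shows "Y \<in> wedge S"
  unfolding wedge_def
proof (intro CollectI allI impI)
  fix t :: real assume t: "0 \<le> t"
  have lim: "(\<lambda>k. exp (t *\<^sub>R X k)) \<longlonglongrightarrow> exp (t *\<^sub>R Y)"
    by (intro tendsto_exp_banach tendsto_intros assms)
  show "exp (t *\<^sub>R Y) \<in> S"
    by (rule closed_sequentially[OF closed _ lim]) (use assms(1) t in \<open>auto simp: wedge_def\<close>)
qed

text \<open>Conjugation by an invertible g commutes with \<open>exp\<close>, so the conjugated
  semigroup is \<open>g * exp (t Y) * h\<close> with h the inverse of g. Both signs of X are assumed
  so that g and h lie in \<open>S\<close>.\<close>

lemma wedge_conj:
  assumes X: "X \<in> wedge S" "- X \<in> wedge S" and Y: "Y \<in> wedge S" and s: "0 \<le> s"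
  shows "exp (s *\<^sub>R X) * Y * exp (- (s *\<^sub>R X)) \<in> wedge S"
  unfolding wedge_def
proof (intro CollectI allI impI)
  fix t :: real assume t: "0 \<le> t"
  let ?g = "exp (s *\<^sub>R X)" and ?h = "exp (- (s *\<^sub>R X))"
  have "exp (t *\<^sub>R (?g * Y * ?h)) * ?g = ?g * exp (t *\<^sub>R Y)"
    by (rule exp_intertwine) (simp add: mult.assoc)
  then have "exp (t *\<^sub>R (?g * Y * ?h)) * (?g * ?h) = ?g * exp (t *\<^sub>R Y) * ?h"
    by (simp add: mult.assoc[symmetric] del: exp_scaleR_minus)
  then have "exp (t *\<^sub>R (?g * Y * ?h)) = ?g * exp (t *\<^sub>R Y) * ?h" by simp
  moreover have "?g \<in> S" "?h \<in> S" using X s by (auto simp: wedge_def)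
  moreover have "exp (t *\<^sub>R Y) \<in> S" using Y t by (simp add: wedge_def)
  ultimately show "exp (t *\<^sub>R (?g * Y * ?h)) \<in> S" by (simp add: mult)
qed

text \<open>No commutator form of Trotter's formula is needed: the bracket is the derivative at 0 of
  the conjugates of \<open>Y\<close>, whose difference quotients stay in the closed convex cone.\<close>
lemma wedge_bracket:
  assumes X: "X \<in> wedge S" "- X \<in> wedge S" and Y: "Y \<in> wedge S" "- Y \<in> wedge S"
  shows "X * Y - Y * X \<in> wedge S"
proof (rule wedge_lim)
  define G where "G s = exp (s *\<^sub>R X) * Y * exp (s *\<^sub>R (- X))" for s :: real
  define D where "D k = real (Suc k) *\<^sub>R (G (1 / real (Suc k)) - Y)" for k
  show "D k \<in> wedge S" for k
  proof -
    have "G (1 / real (Suc k)) \<in> wedge S"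
      using wedge_conj[OF X Y(1), of "1 / real (Suc k)"] by (simp add: G_def)
    from wedge_add[OF this Y(2)] show ?thesis
      unfolding D_def by (intro wedge_scaleR) auto
  qed
  have "(G has_vector_derivative X * Y - Y * X) (at 0)"
    using has_vector_derivative_mult[OF has_vector_derivative_mult_left[OF
          exp_scaleR_has_vector_derivative_right[of X 0 UNIV], of Y]
        exp_scaleR_has_vector_derivative_right[of "- X" 0 UNIV]]
    by (simp add: G_def[abs_def] algebra_simps)
  then have "((\<lambda>h. (1/h) *\<^sub>R (G h - Y)) \<longlongrightarrow> X * Y - Y * X) (at 0)"
    by (simp add: has_vector_derivative_at_quotient G_def)
  moreover have "filterlim (\<lambda>k. 1 / real (Suc k)) (at 0) sequentially"
    unfolding filterlim_at using LIMSEQ_inverse_real_of_nat by (auto simp: divide_inverse)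
  ultimately have "(\<lambda>k. (1 / (1 / real (Suc k))) *\<^sub>R (G (1 / real (Suc k)) - Y)) \<longlonglongrightarrow> X * Y - Y * X"
    by (rule filterlim_compose)
  then show "D \<longlonglongrightarrow> X * Y - Y * X" by (simp add: D_def[abs_def])
qed

text \<open>A subsequence of the powers \<open>exp (k t A)\<close> converges, so its consecutive
  members become close. Dividing one by its predecessor and going one further step t back gives an
  exponential near \<open>exp (- t A)\<close>. That \<open>K\<close> catches all real s, negative
  ones included, bounds the inverse used in this division.\<close>

lemma wedge_recurrent:
  assumes A: "A \<in> wedge S" and K: "compact K" "\<And>s. exp (s *\<^sub>R A) \<in> K"
  shows "- A \<in> wedge S"
  unfolding wedge_def
proof (intro CollectI allI impI)
  fix t :: real assume t: "0 \<le> t"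
  define U where "U k = exp ((real k * t) *\<^sub>R A)" for k :: nat
  have "\<forall>k. U k \<in> K" using K(2) by (simp add: U_def)
  with K(1) obtain l r where r: "strict_mono r" and l: "(U \<circ> r) \<longlonglongrightarrow> l"
    unfolding compact_def by blast
  obtain C where C: "\<And>x. x \<in> K \<Longrightarrow> norm x \<le> C" using compact_imp_bounded[OF K(1)] bounded_iff by metis
  \<comment> \<open>As \<open>r\<close> is strictly increasing, the gap is at least 1; after
    subtracting 1 the time is still nonnegative and \<open>V k\<close> lies in
    \<open>S\<close>.\<close>
  define V where "V k = exp (((real (r (Suc k)) - real (r k) - 1) * t) *\<^sub>R A)" for k
  have V: "V k - exp (t *\<^sub>R (- A)) = (U (r (Suc k)) - U (r k)) * exp ((- (real (r k) + 1) * t) *\<^sub>R A)" for k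
    unfolding V_def U_def left_diff_distrib exp_scaleR_add[symmetric]
    by (simp add: algebra_simps)
  have VS: "V k \<in> S" for k
  proof -
    have "r k < r (Suc k)" using r by (simp add: strict_mono_Suc_iff)
    then have "0 \<le> (real (r (Suc k)) - real (r k) - 1) * t" using t by simp
    then show ?thesis using A by (simp add: V_def wedge_def)
  qed
  have "(\<lambda>k. (U \<circ> r) (Suc k) - (U \<circ> r) k) \<longlonglongrightarrow> l - l"
    by (intro tendsto_intros LIMSEQ_Suc l)
  then have d: "(\<lambda>k. norm (U (r (Suc k)) - U (r k)) * C) \<longlonglongrightarrow> 0"
    by (intro tendsto_mult_left_zero tendsto_norm_zero) simp
  have "(\<lambda>k. V k - exp (t *\<^sub>R (- A))) \<longlonglongrightarrow> 0"
  proof (rule Lim_null_comparison[OF _ d], intro always_eventually allI)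
    fix k
    show "norm (V k - exp (t *\<^sub>R (- A))) \<le> norm (U (r (Suc k)) - U (r k)) * C"
      unfolding V by (intro order.trans[OF norm_mult_ineq] mult_left_mono C K(2)) auto
  qed
  then have "V \<longlonglongrightarrow> exp (t *\<^sub>R (- A))" by (rule LIM_zero_cancel)
  then show "exp (t *\<^sub>R (- A)) \<in> S" by (rule closed_sequentially[OF closed VS])
qed

end

subsection \<open>Operators on a Banach space containing all finite matrices\<close>

text \<open>The library proves completeness of bounded continuous functions only over metric spaces.\<close>

instantiation nat :: metric_space
begin

definition dist_nat :: "nat \<Rightarrow> nat \<Rightarrow> real" where "dist_nat m n = \<bar>real m - real n\<bar>"
definition uniformity_nat :: "(nat \<times> nat) filter" where
  "uniformity_nat = (INF e\<in>{0 <..}. principal {(x, y). dist x y < e})"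

instance
proof
  fix x y z :: nat
  show "uniformity = (INF e\<in>{0 <..}. principal {(x, y :: nat). dist x y < e})"
    by (rule uniformity_nat_def)
  show "open U = (\<forall>x\<in>U. \<forall>\<^sub>F (x', y) in uniformity. x' = x \<longrightarrow> y \<in> U)" for U :: "nat set"
  proof -
    have eq: "y = x" if "\<bar>real x - real y\<bar> < 1" for x y
      using that by (cases x y rule: linorder_cases) auto
    have "\<forall>\<^sub>F (x', y) in uniformity. x' = x \<longrightarrow> y \<in> U" if "x \<in> U" for x
      unfolding uniformity_nat_def
      by (rule eventually_INF1[of 1]) (use that in \<open>auto simp: eventually_principal dist_nat_def dest!: eq\<close>)
    then show ?thesis by (simp add: open_discrete)
  qed
  show "dist x y = 0 \<longleftrightarrow> x = y" by (simp add: dist_nat_def)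
  show "dist x y \<le> dist x z + dist y z" by (simp add: dist_nat_def)
qed

end

instance bcontfun :: (metric_space, banach) banach ..

lemma open_nat_prod: "open (A :: (nat \<times> nat) set)"
  unfolding open_prod_def
proof
  fix x assume "x \<in> A"
  then show "\<exists>B C. open B \<and> open C \<and> x \<in> B \<times> C \<and> B \<times> C \<subseteq> A"
    by (intro exI[of _ "{fst x}"] exI[of _ "{snd x}"]) (auto simp: open_discrete)
qed

text \<open>One space that contains the matrices of every size: types cannot depend on the dimension.\<close>
type_synonym mspace = "(nat \<times> nat) \<Rightarrow>\<^sub>C complex"

lemma bcontfun_nat_prod: "bounded (range f) \<Longrightarrow> (f :: nat \<times> nat \<Rightarrow> complex) \<in> bcontfun"
  by (simp add: bcontfun_def continuous_on_open_vimage open_nat_prod)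

definition unit_at :: "nat \<times> nat \<Rightarrow> complex \<Rightarrow> mspace" where
  "unit_at p z = Bcontfun (\<lambda>q. if q = p then z else 0)"

lemma unit_at_apply [simp]: "apply_bcontfun (unit_at p z) q = (if q = p then z else 0)"
proof -
  have "range (\<lambda>q. if q = p then z else 0) \<subseteq> {z, 0}" by auto
  then have "bounded (range (\<lambda>q. if q = p then z else 0))"
    by (rule bounded_subset[rotated]) (simp add: finite_imp_bounded)
  then show ?thesis unfolding unit_at_def by (subst Bcontfun_inverse) (auto intro: bcontfun_nat_prod)
qed

lemma norm_apply_le: "norm (apply_bcontfun x p) \<le> norm (x :: mspace)"
  using dist_bounded[of x p 0] by simp

lemma norm_mspace_le: "(\<And>p. norm (apply_bcontfun x p) \<le> b) \<Longrightarrow> norm (x :: mspace) \<le> b"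
  using dist_bound[of x 0 b] by simp

lemma bounded_linear_apply_mspace: "bounded_linear (\<lambda>x :: mspace. apply_bcontfun x p)"
  by (rule bounded_linear_intro[where K = 1]) (auto simp: norm_apply_le)

lemma bounded_linear_unit_at: "bounded_linear (unit_at p)"
proof (rule bounded_linear_intro[where K = 1])
  show "norm (unit_at p z) \<le> norm z * 1" for z by (rule norm_mspace_le) auto
qed (auto intro!: bcontfun_eqI)

lemma norm_unit_at [simp]: "norm (unit_at p z) = norm z"
  by (rule antisym, rule norm_mspace_le, simp, use norm_apply_le[of "unit_at p z" p] in simp)

lemmas apply_mspace_sum = bounded_linear.linear[OF bounded_linear_apply_mspace, THEN linear_sum]

text \<open>A copy of the bounded operators that can carry the multiplication required by the class of
  Banach algebras, in which \<open>exp\<close> is available.\<close>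
typedef sop = "UNIV :: (mspace \<Rightarrow>\<^sub>L mspace) set"
  morphisms blinfun_of_sop sop_of_blinfun ..

setup_lifting type_definition_sop

lift_definition app :: "sop \<Rightarrow> mspace \<Rightarrow> mspace" is blinfun_apply .

instantiation sop :: real_normed_algebra_1
begin

lift_definition norm_sop :: "sop \<Rightarrow> real" is norm .
lift_definition minus_sop :: "sop \<Rightarrow> sop \<Rightarrow> sop" is minus .
lift_definition plus_sop :: "sop \<Rightarrow> sop \<Rightarrow> sop" is plus .
lift_definition uminus_sop :: "sop \<Rightarrow> sop" is uminus .
lift_definition zero_sop :: sop is 0 .
lift_definition one_sop :: sop is id_blinfun .
lift_definition times_sop :: "sop \<Rightarrow> sop \<Rightarrow> sop" is "(o\<^sub>L)" .
lift_definition scaleR_sop :: "real \<Rightarrow> sop \<Rightarrow> sop" is scaleR .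
definition dist_sop :: "sop \<Rightarrow> sop \<Rightarrow> real" where "dist_sop a b = norm (a - b)"
definition uniformity_sop :: "(sop \<times> sop) filter" where
  "uniformity_sop = (INF e\<in>{0 <..}. principal {(x, y). dist x y < e})"
definition open_sop :: "sop set \<Rightarrow> bool" where
  "open_sop S = (\<forall>x\<in>S. \<forall>\<^sub>F (x', y) in uniformity. x' = x \<longrightarrow> y \<in> S)"
definition sgn_sop :: "sop \<Rightarrow> sop" where "sgn_sop x = scaleR (inverse (norm x)) x"

instance
proof
  fix a b c :: sop and r s :: real
  show "dist a b = norm (a - b)" by (rule dist_sop_def)
  show "sgn a = inverse (norm a) *\<^sub>R a" by (simp add: sgn_sop_def)
  show "uniformity = (INF e\<in>{0 <..}. principal {(x, y :: sop). dist x y < e})"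
    by (rule uniformity_sop_def)
  show "open U = (\<forall>x\<in>U. \<forall>\<^sub>F (x', y) in uniformity. x' = x \<longrightarrow> y \<in> U)" for U :: "sop set"
    by (rule open_sop_def)
  show "a * b * c = a * (b * c)" by transfer (auto intro: blinfun_eqI)
  show "(a + b) * c = a * c + b * c" by transfer (auto intro: blinfun_eqI simp: blinfun.bilinear_simps)
  show "a * (b + c) = a * b + a * c" by transfer (auto intro: blinfun_eqI simp: blinfun.bilinear_simps)
  show "r *\<^sub>R a * b = r *\<^sub>R (a * b)" by transfer (auto intro: blinfun_eqI simp: blinfun.bilinear_simps)
  show "a * r *\<^sub>R b = r *\<^sub>R (a * b)" by transfer (auto intro: blinfun_eqI simp: blinfun.bilinear_simps)
  show "1 * a = a" by transfer (auto intro: blinfun_eqI)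
  show "a * 1 = a" by transfer (auto intro: blinfun_eqI)
  show "(0::sop) \<noteq> 1"
  proof (transfer, rule notI)
    assume "(0 :: mspace \<Rightarrow>\<^sub>L mspace) = id_blinfun"
    then have "blinfun_apply (0 :: mspace \<Rightarrow>\<^sub>L mspace) (unit_at (0,0) 1) = unit_at (0,0) 1"
      by (simp only: blinfun_apply_id_blinfun id_apply)
    then have "norm (unit_at (0,0) 1) = 0" by simp
    then show False unfolding norm_unit_at by simp
  qed
  show "norm (a * b) \<le> norm a * norm b" by transfer (rule norm_blinfun_compose)
  show "norm (1::sop) = 1"
  proof transfer
    have "norm (unit_at (0,0) 1) \<le> norm (id_blinfun :: mspace \<Rightarrow>\<^sub>L mspace) * norm (unit_at (0,0) 1)"
      using norm_blinfun[of "id_blinfun :: mspace \<Rightarrow>\<^sub>L mspace" "unit_at (0,0) 1"] by simp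
    then show "norm (id_blinfun :: mspace \<Rightarrow>\<^sub>L mspace) = 1"
      using norm_blinfun_id_le[where 'a = mspace] by simp
  qed
  show "(norm a = 0) = (a = 0)" by transfer simp
  show "norm (a + b) \<le> norm a + norm b" by transfer (rule norm_triangle_ineq)
  show "norm (r *\<^sub>R a) = \<bar>r\<bar> * norm a" by transfer simp
qed (transfer; simp add: algebra_simps)+

end

instance sop :: banach
proof
  fix X :: "nat \<Rightarrow> sop" assume X: "Cauchy X"
  have d: "dist (blinfun_of_sop a) (blinfun_of_sop b) = dist a b" for a b
    unfolding dist_sop_def dist_norm by transfer simp
  have "Cauchy (\<lambda>n. blinfun_of_sop (X n))" using X by (simp add: Cauchy_def d)
  then have "convergent (\<lambda>n. blinfun_of_sop (X n))" by (rule Cauchy_convergent)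
  then obtain l where "(\<lambda>n. blinfun_of_sop (X n)) \<longlonglongrightarrow> l" unfolding convergent_def by auto
  then have "X \<longlonglongrightarrow> sop_of_blinfun l"
    using d[of _ "sop_of_blinfun l"] by (simp add: tendsto_iff sop_of_blinfun_inverse)
  then show "convergent X" by (auto simp: convergent_def)
qed

lemma sop_eqI: "(\<And>x. app S x = app T x) \<Longrightarrow> S = T"
  by transfer (auto intro: blinfun_eqI)

lemma app_mult [simp]: "app (S * T) x = app S (app T x)" by transfer simp

lemma app_one [simp]: "app 1 x = x" by transfer simp

lemma norm_app: "norm (app T x) \<le> norm T * norm x" by transfer (rule norm_blinfun)

lemma bounded_bilinear_app: "bounded_bilinear app"
proof
  show "\<exists>K. \<forall>a b. norm (app a b) \<le> norm a * norm b * K"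
    by (rule exI[of _ 1]) (simp add: norm_app)
qed (transfer; simp add: blinfun.bilinear_simps)+

interpretation app: bounded_bilinear app by (rule bounded_bilinear_app)

lemmas app_simps [simp] = app.add_left app.diff_left app.minus_left app.scaleR_left app.zero_left
  app.add_right app.diff_right app.minus_right app.scaleR_right app.zero_right

lift_definition sop_of :: "(mspace \<Rightarrow> mspace) \<Rightarrow> sop" is Blinfun .

lemma app_sop_of: "bounded_linear f \<Longrightarrow> app (sop_of f) x = f x"
  by transfer (simp add: bounded_linear_Blinfun_apply)

text \<open>Applying \<open>exp (- s L)\<close> to the solution gives a curve with derivative 0.
  Derivatives are taken within the interval to match the segments of the control system.\<close>

lemma exp_ode_unique:
  assumes f: "\<And>s. s \<in> {0..t} \<Longrightarrow> (f has_vector_derivative app L (f s)) (at s within {0..t})"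
    and t: "0 \<le> t"
  shows "f t = app (exp (t *\<^sub>R L)) (f 0)"
proof -
  define h where "h s = app (exp (s *\<^sub>R (- L))) (f s)" for s
  have "(h has_vector_derivative 0) (at s within {0..t})" if "s \<in> {0..t}" for s
    using app.has_vector_derivative[OF exp_scaleR_has_vector_derivative_right[of "- L" s "{0..t}"] f[OF that]]
    by (simp add: h_def[abs_def])
  then obtain c where c: "\<And>s. s \<in> {0..t} \<Longrightarrow> h s = c"
    using has_vector_derivative_zero_constant[of "{0..t}" h] by auto
  have "h t = h 0" using c[of t] c[of 0] t by simp
  then have "app (exp (t *\<^sub>R L)) (h t) = app (exp (t *\<^sub>R L)) (f 0)" by (simp add: h_def)
  then show ?thesis by (simp add: h_def app_mult[symmetric] del: app_mult)
qed

lemma exp_ode_solution: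
  "((\<lambda>s. app (exp (s *\<^sub>R L)) x) has_vector_derivative app L (app (exp (s *\<^sub>R L)) x)) (at s within A)"
  using app.has_vector_derivative[OF exp_scaleR_has_vector_derivative_left[of L s, THEN has_vector_derivative_at_within]
      has_vector_derivative_const[of x]]
  by simp

subsection \<open>Left-right multiplication operators\<close>

locale fixed_dim =
  fixes N :: nat
begin

abbreviation CM :: "complex mat set" where "CM \<equiv> carrier_mat N N"

lemma mult_index:
  assumes "A \<in> CM" "B \<in> CM" "i < N" "j < N"
  shows "(A * B) $$ (i,j) = (\<Sum>k<N. A $$ (i,k) * B $$ (k,j))"
  using assms by (simp add: scalar_prod_def lessThan_atLeast0)

lemma mult_CM [simp, intro]: "A \<in> CM \<Longrightarrow> B \<in> CM \<Longrightarrow> A * B \<in> CM"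
  by (rule mult_carrier_mat)

lemma minus_CM [simp, intro]: "B \<in> CM \<Longrightarrow> A - B \<in> CM"
  by (rule minus_carrier_mat)

lemma adj_carrier [simp, intro]: "A \<in> CM \<Longrightarrow> adj A \<in> CM"
  by (simp add: adj_def)

lemma adj_dim [simp]: "dim_row (adj A) = dim_col A" "dim_col (adj A) = dim_row A"
  by (simp_all add: adj_def)

lemma adj_index: "A \<in> CM \<Longrightarrow> i < N \<Longrightarrow> j < N \<Longrightarrow> adj A $$ (i,j) = cnj (A $$ (j,i))"
  by (simp add: adj_def)

lemma CM_eqI: "A \<in> CM \<Longrightarrow> B \<in> CM \<Longrightarrow> (\<And>i j. i < N \<Longrightarrow> j < N \<Longrightarrow> A $$ (i,j) = B $$ (i,j)) \<Longrightarrow> A = B"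
  by (intro eq_matI) auto

lemma adj_adj: "A \<in> CM \<Longrightarrow> adj (adj A) = A"
  by (rule CM_eqI) (auto simp: adj_index)

lemma adj_add: "A \<in> CM \<Longrightarrow> B \<in> CM \<Longrightarrow> adj (A + B) = adj A + adj B"
  by (rule CM_eqI) (auto simp: adj_index)

lemma adj_smult: "A \<in> CM \<Longrightarrow> adj (c \<cdot>\<^sub>m A) = cnj c \<cdot>\<^sub>m adj A"
  by (rule CM_eqI) (auto simp: adj_index)

lemma adj_mult: "A \<in> CM \<Longrightarrow> B \<in> CM \<Longrightarrow> adj (A * B) = adj B * adj A"
  by (rule CM_eqI) (auto simp: adj_index mult_index mult.commute simp del: index_mult_mat)

lemma smult_diff_CM: "A \<in> CM \<Longrightarrow> B \<in> CM \<Longrightarrow> c \<cdot>\<^sub>m (A - B) = c \<cdot>\<^sub>m A - c \<cdot>\<^sub>m B"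
  by (rule eq_matI) (auto simp: right_diff_distrib)

definition emb :: "complex mat \<Rightarrow> mspace" where
  "emb A = (\<Sum>i<N. \<Sum>j<N. unit_at (i,j) (A $$ (i,j)))"

text \<open>A left inverse of \<open>emb\<close> on N x N matrices. In the other order,
  \<open>emb (unemb x)\<close> cuts x down to its N x N block; that composite is the operator
  \<open>proj\<close>.\<close>

definition unemb :: "mspace \<Rightarrow> complex mat" where
  "unemb x = mat N N (\<lambda>(i,j). apply_bcontfun x (i,j))"

lemma emb_apply: "apply_bcontfun (emb A) (i,j) = (if i < N \<and> j < N then A $$ (i,j) else 0)"
proof -
  have *: "(if i = k \<and> j = l then c else 0) = (if i = k then (if j = l then c else 0) else (0::complex))"
    for k l c by simp
  have "apply_bcontfun (emb A) (i,j) = (\<Sum>k<N. \<Sum>l<N. if i = k \<and> j = l then A $$ (k,l) else 0)"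
    by (simp add: emb_def apply_mspace_sum)
  also have "\<dots> = (\<Sum>k<N. if i = k then (\<Sum>l<N. if j = l then A $$ (k,l) else 0) else 0)"
    unfolding * by (intro sum.cong) auto
  also have "\<dots> = (if i < N \<and> j < N then A $$ (i,j) else 0)"
    by (simp add: sum.delta')
  finally show ?thesis .
qed

lemma unemb_carrier [simp, intro]: "unemb x \<in> CM"
  by (simp add: unemb_def)

lemma unemb_index [simp]: "i < N \<Longrightarrow> j < N \<Longrightarrow> unemb x $$ (i,j) = apply_bcontfun x (i,j)"
  by (simp add: unemb_def)

lemma unemb_emb: "A \<in> CM \<Longrightarrow> unemb (emb A) = A"
  by (rule CM_eqI) (auto simp: emb_apply)

lemma emb_inject: "A \<in> CM \<Longrightarrow> B \<in> CM \<Longrightarrow> emb A = emb B \<longleftrightarrow> A = B"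
  by (metis unemb_emb)

lemma mspace_eqI: "(\<And>i j. apply_bcontfun x (i,j) = apply_bcontfun y (i,j)) \<Longrightarrow> x = (y :: mspace)"
  by (rule bcontfun_eqI) auto

lemma emb_add: "A \<in> CM \<Longrightarrow> B \<in> CM \<Longrightarrow> emb (A + B) = emb A + emb B"
  by (rule mspace_eqI) (auto simp: emb_apply)

lemma emb_diff: "A \<in> CM \<Longrightarrow> B \<in> CM \<Longrightarrow> emb (A - B) = emb A - emb B"
  by (rule mspace_eqI) (auto simp: emb_apply)

lemma emb_uminus: "A \<in> CM \<Longrightarrow> emb (- A) = - emb A"
  by (rule mspace_eqI) (auto simp: emb_apply)

lemma emb_smult: "A \<in> CM \<Longrightarrow> emb (complex_of_real c \<cdot>\<^sub>m A) = c *\<^sub>R emb A"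
  by (rule mspace_eqI) (auto simp: emb_apply scaleR_conv_of_real)

lemma norm_emb_le:
  assumes "\<And>i j. i < N \<Longrightarrow> j < N \<Longrightarrow> cmod (A $$ (i,j)) \<le> b" "0 \<le> b"
  shows "norm (emb A) \<le> b"
proof (rule norm_mspace_le)
  fix p show "cmod (apply_bcontfun (emb A) p) \<le> b"
    using assms by (cases p) (auto simp: emb_apply)
qed

text \<open>The map x to A x B on the block. Passing through \<open>unemb\<close>, it annihilates
  everything off the block, so \<open>LR Id Id\<close> is a projection and not 1.\<close>

definition LR :: "complex mat \<Rightarrow> complex mat \<Rightarrow> sop" where
  "LR A B = sop_of (\<lambda>x. emb (A * unemb x * B))"

lemma bounded_linear_LR:
  assumes A: "A \<in> CM" and B: "B \<in> CM"
  shows "bounded_linear (\<lambda>x. emb (A * unemb x * B))"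
proof -
  have eq: "emb (A * unemb x * B) =
      (\<Sum>i<N. \<Sum>j<N. unit_at (i,j) (\<Sum>l<N. \<Sum>k<N. A $$ (i,k) * apply_bcontfun x (k,l) * B $$ (l,j)))" for x
    unfolding emb_def using A B
    by (intro sum.cong refl arg_cong[where f = "unit_at _"])
      (simp add: mult_index[OF mult_carrier_mat] mult_index sum_distrib_right del: index_mult_mat)
  show ?thesis
    unfolding eq
    by (intro bounded_linear_sum bounded_linear_compose[OF bounded_linear_unit_at]
        bounded_linear_const_mult bounded_linear_mult_const bounded_linear_apply_mspace)
qed

lemma app_LR:
  assumes "A \<in> CM" "B \<in> CM"
  shows "app (LR A B) x = emb (A * unemb x * B)"
  unfolding LR_def by (rule app_sop_of[OF bounded_linear_LR[OF assms]])

lemma app_LR_emb: "A \<in> CM \<Longrightarrow> B \<in> CM \<Longrightarrow> X \<in> CM \<Longrightarrow> app (LR A B) (emb X) = emb (A * X * B)"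
  by (simp add: app_LR unemb_emb)

lemma LR_mult:
  assumes "A \<in> CM" "B \<in> CM" "C \<in> CM" "D \<in> CM"
  shows "LR A B * LR C D = LR (A * C) (D * B)"
proof (rule sop_eqI)
  fix x
  have "A * (C * unemb x * D) * B = (A * C) * unemb x * (D * B)"
    using assms unemb_carrier[of x] by (simp add: assoc_mult_mat[of _ N N _ N _ N])
  then show "app (LR A B * LR C D) x = app (LR (A * C) (D * B)) x"
    using assms by (simp add: app_LR unemb_emb)
qed

lemma LR_add_left: "A \<in> CM \<Longrightarrow> A' \<in> CM \<Longrightarrow> B \<in> CM \<Longrightarrow> LR (A + A') B = LR A B + LR A' B"
  by (rule sop_eqI) (simp add: app_LR add_mult_distrib_mat[of _ N N _ _ N] emb_add)

lemma LR_add_right: "A \<in> CM \<Longrightarrow> B \<in> CM \<Longrightarrow> B' \<in> CM \<Longrightarrow> LR A (B + B') = LR A B + LR A B'"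
  by (rule sop_eqI) (simp add: app_LR mult_add_distrib_mat[of _ N N _ N] emb_add)

lemma LR_diff_left: "A \<in> CM \<Longrightarrow> A' \<in> CM \<Longrightarrow> B \<in> CM \<Longrightarrow> LR (A - A') B = LR A B - LR A' B"
  by (rule sop_eqI) (simp add: app_LR minus_mult_distrib_mat[of _ N N _ _ N] emb_diff)

lemma LR_diff_right: "A \<in> CM \<Longrightarrow> B \<in> CM \<Longrightarrow> B' \<in> CM \<Longrightarrow> LR A (B - B') = LR A B - LR A B'"
  by (rule sop_eqI) (simp add: app_LR mult_minus_distrib_mat[of _ N N _ N] emb_diff)

lemma LR_smult_left: "A \<in> CM \<Longrightarrow> B \<in> CM \<Longrightarrow> LR (complex_of_real c \<cdot>\<^sub>m A) B = c *\<^sub>R LR A B"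
  by (rule sop_eqI) (simp add: app_LR mult_smult_assoc_mat[of _ N N _ N] emb_smult)

lemma LR_smult_right: "A \<in> CM \<Longrightarrow> B \<in> CM \<Longrightarrow> LR A (complex_of_real c \<cdot>\<^sub>m B) = c *\<^sub>R LR A B"
  by (rule sop_eqI) (simp add: app_LR mult_smult_distrib[of _ N N _ N] emb_smult)

abbreviation Id :: "complex mat" where "Id \<equiv> 1\<^sub>m N"

lemma Id_mult [simp]: "A \<in> CM \<Longrightarrow> Id * A = A" "A \<in> CM \<Longrightarrow> A * Id = A"
  by (rule left_mult_one_mat, assumption) (rule right_mult_one_mat)

definition proj :: sop where "proj = LR Id Id"

lemma app_proj: "app proj x = emb (unemb x)"
  by (simp add: proj_def app_LR)

lemma LR_proj [simp]:
  assumes "A \<in> CM" "B \<in> CM" shows "LR A B * proj = LR A B" "proj * LR A B = LR A B"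
  using assms by (simp_all add: proj_def LR_mult)

definition ad :: "complex mat \<Rightarrow> sop" where "ad X = LR X Id - LR Id X"

lemma ad_lin:
  assumes "X \<in> CM" "Y \<in> CM"
  shows "ad (complex_of_real a \<cdot>\<^sub>m X + Y) = a *\<^sub>R ad X + ad Y"
  using assms
  by (simp add: ad_def LR_add_left LR_add_right LR_smult_left LR_smult_right algebra_simps)

lemma ad_bracket:
  assumes "X \<in> CM" "Y \<in> CM"
  shows "ad (X * Y - Y * X) = ad X * ad Y - ad Y * ad X"
  using assms
  by (simp add: ad_def LR_diff_left LR_diff_right LR_mult algebra_simps)

lemma app_ad_emb:
  assumes "X \<in> CM" "A \<in> CM"
  shows "app (ad X) (emb A) = emb (X * A - A * X)"
  using assms by (simp add: ad_def app_LR_emb emb_diff)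

lemma ad_proj: "X \<in> CM \<Longrightarrow> ad X * proj = ad X" "X \<in> CM \<Longrightarrow> proj * ad X = ad X"
  by (simp_all add: ad_def algebra_simps)

text \<open>The negative of \<open>Gamma_a\<close>, that is, the generator itself at unit noise
  amplitude.\<close>

definition damping :: sop where
  "damping = LR (V_a N) (adj (V_a N))
     - (1/2) *\<^sub>R (LR (adj (V_a N) * V_a N) Id + LR Id (adj (V_a N) * V_a N))"

lemma V_carrier [simp, intro]: "V_a N \<in> CM" by (simp add: V_a_def)

lemma VV_carrier [simp, intro]: "adj (V_a N) * V_a N \<in> CM"
  by (rule mult_carrier_mat) auto

lemma damping_proj: "damping * proj = damping" "proj * damping = damping"
  by (simp_all add: damping_def algebra_simps)

lemma emb_Gamma:
  assumes [simp]: "A \<in> CM"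
  shows "app damping (emb A) = - emb (Gamma_a N A)"
proof -
  have [simp]: "V_a N * A * adj (V_a N) \<in> CM" by (intro mult_carrier_mat[of _ N N]) auto
  have [simp]: "adj (V_a N) * V_a N * A \<in> CM" "A * (adj (V_a N) * V_a N) \<in> CM"
    by (intro mult_carrier_mat[of _ N N]; auto)+
  have half: "(1/2::complex) = complex_of_real (1/2)" by simp
  show ?thesis unfolding Gamma_a_def half
    by (simp add: damping_def app_LR_emb emb_uminus emb_diff emb_smult emb_add del: of_real_divide)
qed

definition gen_op :: "complex mat \<Rightarrow> real \<Rightarrow> sop" where
  "gen_op H g = g *\<^sub>R damping - ad (\<i> \<cdot>\<^sub>m H)"

lemma gen_op_proj: "H \<in> CM \<Longrightarrow> gen_op H g * proj = gen_op H g" "H \<in> CM \<Longrightarrow> proj * gen_op H g = gen_op H g"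
  by (simp_all add: gen_op_def ad_proj damping_proj algebra_simps)

lemma Hu_carrier [simp]: "H_u N H0 Hs u \<in> CM" by (simp add: H_u_def)

lemma Gamma_carrier: "A \<in> CM \<Longrightarrow> Gamma_a N A \<in> CM"
  unfolding Gamma_a_def by (intro uminus_carrier_mat minus_carrier_mat smult_carrier_mat add_carrier_mat mult_carrier_mat[of _ N N]) auto

lemma emb_gen_L:
  assumes [simp]: "A \<in> CM"
  shows "app (gen_op (H_u N H0 Hs u) g) (emb A) = emb (gen_L N H0 Hs u g A)"
proof -
  let ?H = "H_u N H0 Hs u"
  have [simp]: "?H * A \<in> CM" "A * ?H \<in> CM" by (intro mult_carrier_mat[of _ N N]; simp)+
  then have [simp]: "\<i> \<cdot>\<^sub>m (?H * A - A * ?H) \<in> CM" by (simp add: minus_carrier_mat)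
  have "(\<i> \<cdot>\<^sub>m ?H) * A - A * (\<i> \<cdot>\<^sub>m ?H) = \<i> \<cdot>\<^sub>m (?H * A - A * ?H)"
    by (simp add: mult_smult_assoc_mat[of _ N N _ N] mult_smult_distrib[of _ N N _ N] smult_diff_CM)
  then show ?thesis
    by (simp add: gen_op_def app_ad_emb emb_Gamma gen_L_def emb_uminus emb_add emb_smult Gamma_carrier)
qed

end

lemma compact_PiE_Icc: "compact (PiE UNIV (\<lambda>_::'i. {- C..C::real}))"
proof -
  have "compactin (product_topology (\<lambda>_::'i. euclidean) UNIV) (PiE UNIV (\<lambda>_. {- C..C::real}))"
    unfolding compactin_PiE by auto
  then show ?thesis by (simp add: euclidean_product_topology)
qed

text \<open>Compactness inside an infinite-dimensional space: a cube of coefficients is compact by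
  Tychonoff, and the linear combination depends continuously on its coordinates.\<close>

lemma compact_linear_combinations:
  fixes b :: "'i \<Rightarrow> 'a::real_normed_vector"
  shows "compact ((\<lambda>c. v + (\<Sum>i\<in>I. c i *\<^sub>R b i)) ` PiE UNIV (\<lambda>_. {- C..C}))"
  by (intro compact_continuous_image compact_PiE_Icc continuous_intros
      continuous_on_subset[OF continuous_on_product_coordinates]) auto

context fixed_dim
begin

subsection \<open>Segments of the control system as operator exponentials\<close>

lemma app_proj_emb: "A \<in> CM \<Longrightarrow> app proj (emb A) = emb A"
  by (simp add: app_proj unemb_emb)

text \<open>The exponential is the identity off the block, so \<open>proj\<close> does not absorb
  into it as it does into L. Commuting with \<open>proj\<close> is what survives, and it keeps
  embedded matrices embedded.\<close>

lemma exp_proj_commute: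
  assumes "L * proj = L" "proj * L = L"
  shows "exp (t *\<^sub>R L) * proj = proj * exp (t *\<^sub>R L)"
  by (rule exp_intertwine) (simp add: assms)

lemma exp_emb:
  assumes "L * proj = L" "proj * L = L" "A \<in> CM"
  shows "emb (unemb (app (exp (t *\<^sub>R L)) (emb A))) = app (exp (t *\<^sub>R L)) (emb A)"
  using arg_cong[OF exp_proj_commute[OF assms(1,2)], of "\<lambda>T. app T (emb A)" t] assms(3)
  by (simp add: app_proj_emb) (simp add: app_proj)

text \<open>The finitely many entrywise equations add up to one linear differential equation in
  \<open>mspace\<close>. Uniqueness identifies the end point of a given trajectory; conversely, the
  exponential curve, read back by \<open>unemb\<close>, is a trajectory.\<close>

lemma seg_step_iff:
  assumes A: "A \<in> CM"
  shows "seg_step N H0 Hs gs A B \<longleftrightarrow> B \<in> CM \<and> (\<exists>u g t. length u = length Hs \<and> g \<in> {0, gs} \<and> 0 \<le> t \<and>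
    emb B = app (exp (t *\<^sub>R gen_op (H_u N H0 Hs u) g)) (emb A))" (is "?l \<longleftrightarrow> ?r")
proof
  assume ?l
  then obtain u g t f where u: "length u = length Hs" "g \<in> {0, gs}" and t: "0 \<le> t"
    and f: "f 0 = A" "f t = B" "\<And>s. s \<in> {0..t} \<Longrightarrow> f s \<in> CM"
    and df: "\<And>s i j. s \<in> {0..t} \<Longrightarrow> i < N \<Longrightarrow> j < N \<Longrightarrow> ((\<lambda>r. f r $$ (i,j)) has_vector_derivative
                (gen_L N H0 Hs u g (f s)) $$ (i,j)) (at s within {0..t})"
    unfolding seg_step_def by blast
  let ?L = "gen_op (H_u N H0 Hs u) g"
  have "((\<lambda>s. emb (f s)) has_vector_derivative app ?L (emb (f s))) (at s within {0..t})"
    if s: "s \<in> {0..t}" for s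
    unfolding emb_gen_L[OF f(3)[OF s]] unfolding emb_def
    by (intro has_vector_derivative_sum bounded_linear.has_vector_derivative[OF bounded_linear_unit_at]
        df s) auto
  from exp_ode_unique[where f = "\<lambda>s. emb (f s)", OF this t]
  have "emb B = app (exp (t *\<^sub>R ?L)) (emb A)" by (simp add: f)
  moreover have "B \<in> CM" using f(2) f(3)[of t] t by auto
  ultimately show ?r using u t by blast
next
  assume ?r
  then obtain u g t where B: "B \<in> CM" and u: "length u = length Hs" "g \<in> {0, gs}" and t: "0 \<le> t"
    and e: "emb B = app (exp (t *\<^sub>R gen_op (H_u N H0 Hs u) g)) (emb A)" by blast
  let ?L = "gen_op (H_u N H0 Hs u) g"
  define f where "f s = unemb (app (exp (s *\<^sub>R ?L)) (emb A))" for s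
  have emb_f: "emb (f s) = app (exp (s *\<^sub>R ?L)) (emb A)" for s
    unfolding f_def by (rule exp_emb) (simp_all add: gen_op_proj A)
  have "((\<lambda>r. f r $$ (i,j)) has_vector_derivative (gen_L N H0 Hs u g (f s)) $$ (i,j)) (at s within {0..t})"
    if ij: "i < N" "j < N" for s i j
  proof -
    have 1: "(\<lambda>r. f r $$ (i,j)) = (\<lambda>r. apply_bcontfun (app (exp (r *\<^sub>R ?L)) (emb A)) (i,j))"
      using ij by (simp add: f_def)
    have "((\<lambda>r. apply_bcontfun (app (exp (r *\<^sub>R ?L)) (emb A)) (i,j)) has_vector_derivative
        apply_bcontfun (app ?L (app (exp (s *\<^sub>R ?L)) (emb A))) (i,j)) (at s within {0..t})"
      by (rule bounded_linear.has_vector_derivative[OF bounded_linear_apply_mspace exp_ode_solution])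
    also have "app ?L (app (exp (s *\<^sub>R ?L)) (emb A)) = emb (gen_L N H0 Hs u g (f s))"
      unfolding emb_f[symmetric] by (rule emb_gen_L) (simp add: f_def)
    finally show ?thesis unfolding 1 using ij by (simp add: emb_apply)
  qed
  moreover have "f 0 = A" using A by (simp add: f_def unemb_emb)
  moreover have "f t = B" using B by (simp add: f_def unemb_emb e[symmetric])
  moreover have "f s \<in> CM" for s by (simp add: f_def)
  ultimately show ?l unfolding seg_step_def using u t by blast
qed

subsection \<open>Unitary evolution is isometric and recurrent\<close>

text \<open>The squared Hilbert-Schmidt norm of the block; its root is only a seminorm on
  \<open>mspace\<close>.\<close>

definition hs :: "mspace \<Rightarrow> real" where
  "hs x = (\<Sum>i<N. \<Sum>j<N. (cmod (apply_bcontfun x (i,j)))\<^sup>2)"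

definition skew :: "complex mat \<Rightarrow> bool" where
  "skew X \<longleftrightarrow> X \<in> CM \<and> adj X = - X"

lemma skew_index: "skew X \<Longrightarrow> i < N \<Longrightarrow> j < N \<Longrightarrow> cnj (X $$ (i,j)) = - X $$ (j,i)"
  unfolding skew_def using adj_index[of X j i] by auto

lemma Re_zero_if_cnj_eq_uminus: "cnj z = - z \<Longrightarrow> Re z = 0"
  by (simp add: complex_eq_iff)

text \<open>The form <f, X f> is purely imaginary for anti-Hermitian X: conjugating and exchanging
  the two row indices reproduces it with the opposite sign.\<close>

lemma skew_form_left:
  assumes X: "skew X"
  shows "Re (\<Sum>i<N. \<Sum>j<N. cnj (f i j) * (\<Sum>k<N. X $$ (i,k) * f k j)) = 0"
proof -
  let ?T = "\<Sum>i<N. \<Sum>j<N. \<Sum>k<N. cnj (f i j) * (X $$ (i,k) * f k j)"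
  have "cnj ?T = (\<Sum>i<N. \<Sum>j<N. \<Sum>k<N. - (cnj (f k j) * (X $$ (k,i) * f i j)))"
    using X by (auto simp: skew_index intro!: sum.cong)
  also have "\<dots> = - (\<Sum>j<N. \<Sum>i<N. \<Sum>k<N. cnj (f k j) * (X $$ (k,i) * f i j))"
    by (simp only: sum_negf) (subst sum.swap, rule refl)
  also have "\<dots> = - (\<Sum>j<N. \<Sum>k<N. \<Sum>i<N. cnj (f k j) * (X $$ (k,i) * f i j))"
    by (subst (2) sum.swap, rule refl)
  also have "\<dots> = - ?T" by (subst sum.swap, rule refl)
  finally have "cnj ?T = - ?T" .
  then have "Re ?T = 0" by (rule Re_zero_if_cnj_eq_uminus)
  then show ?thesis by (simp add: sum_distrib_left)
qed

lemma skew_form_right: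
  assumes X: "skew X"
  shows "Re (\<Sum>i<N. \<Sum>j<N. cnj (f i j) * (\<Sum>k<N. f i k * X $$ (k,j))) = 0"
proof -
  let ?T = "\<Sum>i<N. \<Sum>j<N. \<Sum>k<N. cnj (f i j) * (f i k * X $$ (k,j))"
  have "cnj ?T = (\<Sum>i<N. \<Sum>j<N. \<Sum>k<N. - (cnj (f i k) * (f i j * X $$ (j,k))))"
    using X by (auto simp: skew_index intro!: sum.cong)
  also have "\<dots> = - (\<Sum>i<N. \<Sum>k<N. \<Sum>j<N. cnj (f i k) * (f i j * X $$ (j,k)))"
    by (simp only: sum_negf) (subst (2) sum.swap, rule refl)
  finally have "cnj ?T = - ?T" .
  then have "Re ?T = 0" by (rule Re_zero_if_cnj_eq_uminus)
  then show ?thesis by (simp add: sum_distrib_left)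
qed

lemma app_ad_index:
  assumes "X \<in> CM" "i < N" "j < N"
  shows "apply_bcontfun (app (ad X) x) (i,j) =
    (\<Sum>k<N. X $$ (i,k) * apply_bcontfun x (k,j)) - (\<Sum>k<N. apply_bcontfun x (i,k) * X $$ (k,j))"
  using assms by (simp add: ad_def app_LR emb_apply mult_index del: index_mult_mat)

lemma inner_eq_Re_cnj: "(z::complex) \<bullet> w = Re (cnj z * w)"
  by (simp add: inner_complex_def)

text \<open>Along the flow y the derivative of \<open>hs\<close> is 2 Re <y, X y - y X>, and both
  terms vanish by \<open>skew_form_left\<close> and \<open>skew_form_right\<close>.\<close>

lemma hs_exp_ad:
  assumes X: "skew X"
  shows "hs (app (exp (s *\<^sub>R ad X)) x) = hs x"
proof -
  have XC: "X \<in> CM" using X by (simp add: skew_def)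
  define y where "y s = app (exp (s *\<^sub>R ad X)) x" for s
  let ?e = "\<lambda>s i j. apply_bcontfun (y s) (i,j)"
  have de: "((\<lambda>s. ?e s i j) has_vector_derivative apply_bcontfun (app (ad X) (y s)) (i,j)) (at s)" for s i j
    unfolding y_def by (rule bounded_linear.has_vector_derivative[OF bounded_linear_apply_mspace exp_ode_solution])
  have "((\<lambda>s. hs (y s)) has_vector_derivative 0) (at s)" for s
  proof -
    have eq: "(\<lambda>s. hs (y s)) = (\<lambda>s. \<Sum>i<N. \<Sum>j<N. ?e s i j \<bullet> ?e s i j)"
      by (simp add: hs_def power2_norm_eq_inner)
    have "((\<lambda>s. hs (y s)) has_vector_derivative
      (\<Sum>i<N. \<Sum>j<N. ?e s i j \<bullet> apply_bcontfun (app (ad X) (y s)) (i,j)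
          + apply_bcontfun (app (ad X) (y s)) (i,j) \<bullet> ?e s i j)) (at s)"
      unfolding eq by (intro has_vector_derivative_sum
          bounded_bilinear.has_vector_derivative[OF bounded_bilinear_inner] de)
    moreover have "(\<Sum>i<N. \<Sum>j<N. ?e s i j \<bullet> apply_bcontfun (app (ad X) (y s)) (i,j)) =
       Re (\<Sum>i<N. \<Sum>j<N. cnj (?e s i j) * (\<Sum>k<N. X $$ (i,k) * ?e s k j)) -
       Re (\<Sum>i<N. \<Sum>j<N. cnj (?e s i j) * (\<Sum>k<N. ?e s i k * X $$ (k,j)))"
      unfolding inner_eq_Re_cnj Re_sum[symmetric] minus_complex.simps(1)[symmetric]
        sum_subtractf[symmetric] right_diff_distrib[symmetric]
      using XC by (intro arg_cong[where f = Re] sum.cong) (auto simp: app_ad_index sum_subtractf)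
    ultimately show ?thesis
      unfolding skew_form_left[OF X] skew_form_right[OF X]
      by (simp add: sum_distrib_left[symmetric] inner_commute)
  qed
  then obtain c where "\<And>s. s \<in> UNIV \<Longrightarrow> hs (y s) = c"
    using has_vector_derivative_zero_constant[of UNIV "\<lambda>s. hs (y s)"] by auto
  then have "hs (y s) = hs (y 0)" by simp
  then show ?thesis by (simp add: y_def)
qed

lemma cmod_le_hs:
  assumes "i < N" "j < N"
  shows "cmod (apply_bcontfun x (i,j)) \<le> sqrt (hs x)"
proof -
  have "(cmod (apply_bcontfun x (i,j)))\<^sup>2 \<le> (\<Sum>j<N. (cmod (apply_bcontfun x (i,j)))\<^sup>2)"
    by (rule member_le_sum) (use assms in auto)
  also have "\<dots> \<le> hs x" unfolding hs_def
    by (rule member_le_sum[where f = "\<lambda>i. \<Sum>j<N. (cmod (apply_bcontfun x (i,j)))\<^sup>2"])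
      (use assms in \<open>auto intro: sum_nonneg\<close>)
  finally show ?thesis by (simp add: real_le_rsqrt)
qed

text \<open>Members of \<open>sop\<close> are merely real-linear, so every complex entry contributes
  two directions, 1 and i.\<close>

definition ix :: "((nat \<times> nat) \<times> complex) set" where
  "ix = ({..<N} \<times> {..<N}) \<times> {1, \<i>}"

definition basis :: "(nat \<times> nat) \<times> complex \<Rightarrow> mspace" where
  "basis a = unit_at (fst a) (snd a)"

definition coord :: "(nat \<times> nat) \<times> complex \<Rightarrow> mspace \<Rightarrow> real" where
  "coord a x = apply_bcontfun x (fst a) \<bullet> snd a"

lemma bounded_linear_coord: "bounded_linear (coord a)"
  unfolding coord_def
  by (rule bounded_linear_compose[OF bounded_linear_inner_left bounded_linear_apply_mspace])

lemma app_proj_coord: "app proj x = (\<Sum>a\<in>ix. coord a x *\<^sub>R basis a)"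
proof -
  have "(\<Sum>a\<in>ix. coord a x *\<^sub>R basis a) = (\<Sum>p\<in>{..<N} \<times> {..<N}. \<Sum>d\<in>{1, \<i>}.
      (apply_bcontfun x p \<bullet> d) *\<^sub>R unit_at p d)"
    unfolding ix_def coord_def basis_def sum.cartesian_product by (simp only: split_def)
  also have "\<dots> = (\<Sum>p\<in>{..<N} \<times> {..<N}. unit_at p (apply_bcontfun x p))"
  proof (rule sum.cong[OF refl])
    fix p
    have "(\<Sum>d\<in>{1, \<i>}. (apply_bcontfun x p \<bullet> d) *\<^sub>R unit_at p d) =
      unit_at p (Re (apply_bcontfun x p) *\<^sub>R 1 + Im (apply_bcontfun x p) *\<^sub>R \<i>)"
      using linear_add[OF bounded_linear.linear[OF bounded_linear_unit_at]]
        linear_scale[OF bounded_linear.linear[OF bounded_linear_unit_at]]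
      by (simp add: inner_complex_def)
    also have "Re (apply_bcontfun x p) *\<^sub>R 1 + Im (apply_bcontfun x p) *\<^sub>R \<i> = apply_bcontfun x p"
      by (simp add: complex_eq_iff)
    finally show "(\<Sum>d\<in>{1, \<i>}. (apply_bcontfun x p \<bullet> d) *\<^sub>R unit_at p d) = unit_at p (apply_bcontfun x p)" .
  qed
  also have "\<dots> = (\<Sum>i<N. \<Sum>j<N. unit_at (i,j) (apply_bcontfun x (i,j)))"
    by (simp add: sum.cartesian_product)
  finally show ?thesis by (simp add: app_proj emb_def)
qed

definition rank_one :: "(nat \<times> nat) \<times> complex \<Rightarrow> (nat \<times> nat) \<times> complex \<Rightarrow> sop" where
  "rank_one a b = sop_of (\<lambda>x. coord a x *\<^sub>R basis b)"

lemma app_rank_one: "app (rank_one a b) x = coord a x *\<^sub>R basis b"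
  unfolding rank_one_def
  by (rule app_sop_of) (rule bounded_linear_compose[OF bounded_linear_scaleR_left bounded_linear_coord])

lemma app_sum_left: "app (\<Sum>i\<in>I. T i) x = (\<Sum>i\<in>I. app (T i) x)"
  by (rule app.sum_left)

text \<open>The matrix of T on the block, with respect to the real basis: finitely many coefficients
  determine the compressed operator, which prepares the compactness argument for recurrence.\<close>

lemma proj_conj_expand:
  "proj * T * proj = (\<Sum>(a,b)\<in>ix \<times> ix. coord b (app T (basis a)) *\<^sub>R rank_one a b)"
proof (rule sop_eqI)
  fix x
  have "app (proj * T * proj) x = (\<Sum>b\<in>ix. coord b (app T (\<Sum>a\<in>ix. coord a x *\<^sub>R basis a)) *\<^sub>R basis b)"
    by (simp add: app_proj_coord)
  also have "\<dots> = (\<Sum>b\<in>ix. \<Sum>a\<in>ix. (coord a x * coord b (app T (basis a))) *\<^sub>R basis b)"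
    by (simp add: app.sum_right linear_sum[OF bounded_linear.linear[OF bounded_linear_coord]]
        linear_scale[OF bounded_linear.linear[OF bounded_linear_coord]] scaleR_sum_left)
  also have "\<dots> = (\<Sum>a\<in>ix. \<Sum>b\<in>ix. coord b (app T (basis a)) *\<^sub>R app (rank_one a b) x)"
    by (subst sum.swap) (simp add: app_rank_one mult.commute)
  finally show "app (proj * T * proj) x = app (\<Sum>(a,b)\<in>ix \<times> ix. coord b (app T (basis a)) *\<^sub>R rank_one a b) x"
    by (simp add: sum.cartesian_product app_sum_left split_def)
qed

lemma hs_basis: "a \<in> ix \<Longrightarrow> hs (basis a) = 1"
proof -
  assume "a \<in> ix"
  then obtain i j d where a: "a = ((i,j),d)" "i < N" "j < N" "cmod d = 1" by (auto simp: ix_def)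
  have "hs (basis a) = (\<Sum>k<N. \<Sum>l<N. if k = i then (if l = j then 1 else 0) else 0)"
    unfolding hs_def by (intro sum.cong) (auto simp: basis_def a)
  also have "\<dots> = (\<Sum>k<N. if k = i then (\<Sum>l<N. if l = j then 1 else 0) else 0)"
    by (intro sum.cong) auto
  also have "\<dots> = 1" using a by simp
  finally show ?thesis .
qed

lemma abs_coord_le: "a \<in> ix \<Longrightarrow> \<bar>coord a x\<bar> \<le> sqrt (hs x)"
proof -
  assume "a \<in> ix"
  then obtain i j d where a: "a = ((i,j),d)" "i < N" "j < N" "cmod d = 1" by (auto simp: ix_def)
  have "\<bar>coord a x\<bar> \<le> cmod (apply_bcontfun x (i,j)) * cmod d"
    unfolding coord_def a(1) fst_conv snd_conv by (rule Cauchy_Schwarz_ineq2)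
  also have "\<dots> \<le> sqrt (hs x)" using cmod_le_hs[of i j x] a by simp
  finally show ?thesis .
qed

text \<open>The exponential is the identity off the block plus its compression to the block. The
  coefficients of the compression are bounded by 1 for every s, because the flow is isometric and
  the basis is normalized; hence all exponentials lie in one compact set.\<close>

lemma recurrent_ad:
  assumes S: "closed_semigroup S" and X: "skew X" and W: "ad X \<in> wedge S"
  shows "- ad X \<in> wedge S"
proof (rule closed_semigroup.wedge_recurrent[OF S W])
  have XC: "X \<in> CM" using X by (simp add: skew_def)
  let ?f = "\<lambda>c. (1 - proj) + (\<Sum>p\<in>ix \<times> ix. c p *\<^sub>R (case p of (a,b) \<Rightarrow> rank_one a b))"
  show "compact (?f ` PiE UNIV (\<lambda>_. {- 1..1}))" by (rule compact_linear_combinations)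
  fix s
  let ?T = "exp (s *\<^sub>R ad X)"
  define c where "c = (\<lambda>(a,b). if a \<in> ix \<and> b \<in> ix then coord b (app ?T (basis a)) else 0)"
  have c: "c \<in> PiE UNIV (\<lambda>_. {- 1..1})"
  proof -
    have "\<bar>coord b (app ?T (basis a))\<bar> \<le> 1" if "a \<in> ix" "b \<in> ix" for a b
      using abs_coord_le[OF that(2), of "app ?T (basis a)"] that by (simp add: hs_exp_ad[OF X] hs_basis)
    then show ?thesis by (auto simp: c_def abs_le_iff)
  qed
  have pp: "proj * proj = proj" by (simp add: proj_def LR_mult)
  \<comment> \<open>Intertwining with the zero generator, as
    \<open>(1 - proj) * ad X = 0\<close>.\<close>
  have "(1 - proj) * exp (s *\<^sub>R ad X) = exp 0 * (1 - proj)"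
    by (rule exp_intertwine[symmetric]) (simp add: algebra_simps ad_proj[OF XC])
  then have "?T = (1 - proj) + proj * ?T" by (simp add: algebra_simps)
  also have "proj * ?T = proj * ?T * proj"
    using exp_proj_commute[OF ad_proj[OF XC], of s] pp by (metis mult.assoc)
  also have "\<dots> = (\<Sum>p\<in>ix \<times> ix. c p *\<^sub>R (case p of (a,b) \<Rightarrow> rank_one a b))"
    unfolding proj_conj_expand by (intro sum.cong) (auto simp: c_def)
  finally show "?T \<in> ?f ` PiE UNIV (\<lambda>_. {- 1..1})" using c by blast
qed

subsection \<open>The evolution preserves density matrices\<close>

definition sform :: "complex mat \<Rightarrow> (nat \<Rightarrow> complex) \<Rightarrow> (nat \<Rightarrow> complex) \<Rightarrow> complex" where
  "sform A v w = (\<Sum>i<N. \<Sum>j<N. cnj (v i) * A $$ (i,j) * w j)"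

definition psd :: "complex mat \<Rightarrow> bool" where
  "psd A \<longleftrightarrow> hermitian_mat N A \<and> (\<forall>v. 0 \<le> Re (sform A v v))"

lemma pos1_iff: "A \<in> pos1 N \<longleftrightarrow> psd A \<and> mtrace A = 1"
  by (simp add: pos1_def psd_def sform_def)

text \<open>The new left argument is the vector B^dagger v.\<close>

lemma sform_mult_left:
  assumes "A \<in> CM" "B \<in> CM"
  shows "sform (B * A) v w = sform A (\<lambda>k. \<Sum>i<N. cnj (B $$ (i,k)) * v i) w"
proof -
  have "sform (B * A) v w = (\<Sum>i<N. \<Sum>j<N. \<Sum>k<N. cnj (v i) * (B $$ (i,k) * A $$ (k,j)) * w j)"
    unfolding sform_def using assms
    by (intro sum.cong refl) (simp add: mult_index sum_distrib_left sum_distrib_right del: index_mult_mat(1))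
  also have "\<dots> = (\<Sum>i<N. \<Sum>k<N. \<Sum>j<N. cnj (v i) * (B $$ (i,k) * A $$ (k,j)) * w j)"
    by (rule sum.cong[OF refl], rule sum.swap)
  also have "\<dots> = (\<Sum>k<N. \<Sum>i<N. \<Sum>j<N. cnj (v i) * (B $$ (i,k) * A $$ (k,j)) * w j)"
    by (rule sum.swap)
  also have "\<dots> = (\<Sum>k<N. \<Sum>j<N. \<Sum>i<N. cnj (v i) * (B $$ (i,k) * A $$ (k,j)) * w j)"
    by (rule sum.cong[OF refl], rule sum.swap)
  also have "\<dots> = sform A (\<lambda>k. \<Sum>i<N. cnj (B $$ (i,k)) * v i) w"
    unfolding sform_def by (intro sum.cong refl) (simp add: sum_distrib_left sum_distrib_right mult_ac)
  finally show ?thesis .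
qed

lemma sform_mult_right:
  assumes "A \<in> CM" "C \<in> CM"
  shows "sform (A * C) v w = sform A v (\<lambda>k. \<Sum>j<N. C $$ (k,j) * w j)"
proof -
  have "sform (A * C) v w = (\<Sum>i<N. \<Sum>j<N. \<Sum>k<N. cnj (v i) * (A $$ (i,k) * C $$ (k,j)) * w j)"
    unfolding sform_def using assms
    by (intro sum.cong refl) (simp add: mult_index sum_distrib_left sum_distrib_right del: index_mult_mat(1))
  also have "\<dots> = (\<Sum>i<N. \<Sum>k<N. \<Sum>j<N. cnj (v i) * (A $$ (i,k) * C $$ (k,j)) * w j)"
    by (rule sum.cong[OF refl], rule sum.swap)
  also have "\<dots> = sform A v (\<lambda>k. \<Sum>j<N. C $$ (k,j) * w j)"
    unfolding sform_def by (intro sum.cong refl) (simp add: sum_distrib_left mult_ac)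
  finally show ?thesis .
qed

lemma psd_carrier: "psd A \<Longrightarrow> A \<in> CM"
  by (simp add: psd_def hermitian_mat_def)

lemma psd_congruence:
  assumes A: "psd A" and B: "B \<in> CM"
  shows "psd (B * A * adj B)"
proof -
  have AC: "A \<in> CM" "adj A = A" using A by (auto simp: psd_def hermitian_mat_def)
  have "adj (B * A * adj B) = B * A * adj B"
    using AC B by (simp add: adj_mult adj_adj assoc_mult_mat[of _ N N _ N _ N])
  moreover have "sform (B * A * adj B) v v = sform A (\<lambda>k. \<Sum>i<N. cnj (B $$ (i,k)) * v i)
      (\<lambda>k. \<Sum>i<N. cnj (B $$ (i,k)) * v i)" for v
    using AC B unfolding sform_mult_right[OF mult_CM[OF B AC(1)] adj_carrier[OF B]] sform_mult_left[OF AC(1) B]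
    by (auto simp: sform_def adj_index intro!: sum.cong)
  ultimately show ?thesis using A AC B by (simp add: psd_def hermitian_mat_def)
qed

lemma psd_add:
  assumes "psd A" "psd B" "0 \<le> c"
  shows "psd (A + complex_of_real c \<cdot>\<^sub>m B)"
proof -
  have C: "A \<in> CM" "B \<in> CM" using assms by (auto simp: psd_carrier)
  have "sform (A + complex_of_real c \<cdot>\<^sub>m B) v v = sform A v v + complex_of_real c * sform B v v" for v
  proof -
    have "sform (A + complex_of_real c \<cdot>\<^sub>m B) v v =
        (\<Sum>i<N. \<Sum>j<N. cnj (v i) * A $$ (i,j) * v j + complex_of_real c * (cnj (v i) * B $$ (i,j) * v j))"
      unfolding sform_def using C by (intro sum.cong refl) (simp add: algebra_simps)
    then show ?thesis by (simp add: sform_def sum.distrib sum_distrib_left)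
  qed
  then show ?thesis using assms C
    by (simp add: psd_def hermitian_mat_def adj_add adj_smult)
qed

definition psd_cone :: "mspace set" where "psd_cone = emb ` {A. psd A}"

text \<open>Hermiticity and each of the inequalities are closed conditions on the entries; being
  supported on the block is the fixed-point condition of the continuous map
  \<open>proj\<close>.\<close>

lemma psd_cone_lim:
  assumes x: "\<And>k. x k \<in> psd_cone" and lim: "x \<longlonglongrightarrow> y"
  shows "y \<in> psd_cone"
proof -
  obtain A where A: "\<And>k. psd (A k)" "\<And>k. x k = emb (A k)"
    using x unfolding psd_cone_def image_iff by (metis mem_Collect_eq)
  note AC = psd_carrier[OF A(1)]
  have "app proj (x k) = x k" for k by (simp add: A(2) app_proj_emb AC)
  then have "x \<longlonglongrightarrow> app proj y"
    using app.tendsto[OF tendsto_const[of proj] lim] by simp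
  then have py: "y = emb (unemb y)" using lim LIMSEQ_unique app_proj by metis
  have ent: "(\<lambda>k. A k $$ (i,j)) \<longlonglongrightarrow> unemb y $$ (i,j)" if "i < N" "j < N" for i j
    using bounded_linear.tendsto[OF bounded_linear_apply_mspace lim, of "(i,j)"] that
    by (simp add: A(2) emb_apply)
  have "adj (unemb y) = unemb y"
  proof (rule CM_eqI)
    fix i j assume ij: "i < N" "j < N"
    have "cnj (A k $$ (j,i)) = A k $$ (i,j)" for k
      using A(1)[of k] ij adj_index[OF AC, of i j k] by (simp add: psd_def hermitian_mat_def)
    then have "(\<lambda>k. A k $$ (i,j)) \<longlonglongrightarrow> cnj (unemb y $$ (j,i))"
      using tendsto_cnj[OF ent[OF ij(2,1)]] by simp
    then show "adj (unemb y) $$ (i,j) = unemb y $$ (i,j)"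
      using LIMSEQ_unique[OF _ ent[OF ij]] ij by (simp add: adj_index del: unemb_index)
  qed auto
  moreover have "0 \<le> Re (sform (unemb y) v v)" for v
  proof (rule LIMSEQ_le_const)
    show "(\<lambda>k. Re (sform (A k) v v)) \<longlonglongrightarrow> Re (sform (unemb y) v v)"
      unfolding sform_def by (intro tendsto_intros ent) auto
    show "\<exists>n. \<forall>k\<ge>n. 0 \<le> Re (sform (A k) v v)" using A(1) by (simp add: psd_def)
  qed
  ultimately have "psd (unemb y)" by (simp add: psd_def hermitian_mat_def)
  then show ?thesis using py unfolding psd_cone_def by blast
qed

abbreviation W :: "complex mat" where "W \<equiv> adj (V_a N) * V_a N"

lemma V_dim [simp]: "dim_row (V_a N) = N" "dim_col (V_a N) = N"
  by (simp_all add: V_a_def)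

text \<open>The effective non-Hermitian generator K of the quantum-jump picture: the full generator
  sends rho to K rho + rho K^dagger + g V rho V^dagger.\<close>

definition effK :: "complex mat \<Rightarrow> real \<Rightarrow> complex mat" where
  "effK H g = complex_of_real (- 1) \<cdot>\<^sub>m (\<i> \<cdot>\<^sub>m H) + complex_of_real (- g / 2) \<cdot>\<^sub>m W"

lemma effK_carrier [simp]: "H \<in> CM \<Longrightarrow> effK H g \<in> CM"
  by (simp add: effK_def)

lemma adj_effK:
  assumes "hermitian_mat N H"
  shows "adj (effK H g) = \<i> \<cdot>\<^sub>m H + complex_of_real (- g / 2) \<cdot>\<^sub>m W"
proof (rule CM_eqI)
  have H: "H \<in> CM" "adj H = H" using assms by (auto simp: hermitian_mat_def)
  have W: "adj W = W" by (simp add: adj_mult adj_adj)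
  fix i j assume ij: "i < N" "j < N"
  have "cnj (H $$ (j,i)) = H $$ (i,j)" using adj_index[OF H(1) ij] H(2) by simp
  moreover have "cnj (W $$ (j,i)) = W $$ (i,j)" using adj_index[OF VV_carrier ij] W by simp
  ultimately show "adj (effK H g) $$ (i,j) = (\<i> \<cdot>\<^sub>m H + complex_of_real (- g / 2) \<cdot>\<^sub>m W) $$ (i,j)"
    using H ij by (simp add: adj_index effK_def del: index_mult_mat(1))
qed (use assms in \<open>auto simp: hermitian_mat_def\<close>)

text \<open>Adding the second-order term makes the Euler step of the master equation a sum of
  congruences, hence positive.\<close>
lemma euler_step_factor:
  assumes H: "hermitian_mat N H"
  shows "1 + h *\<^sub>R gen_op H g + h\<^sup>2 *\<^sub>R LR (effK H g) (adj (effK H g)) =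
    (1 - proj) + LR (Id + complex_of_real h \<cdot>\<^sub>m effK H g) (adj (Id + complex_of_real h \<cdot>\<^sub>m effK H g))
      + (h * g) *\<^sub>R LR (V_a N) (adj (V_a N))"
proof -
  have [simp]: "H \<in> CM" "\<i> \<cdot>\<^sub>m H \<in> CM" using H by (auto simp: hermitian_mat_def)
  let ?K = "effK H g"
  have [simp]: "?K \<in> CM" "adj ?K \<in> CM" by auto
  have "adj Id = Id" by (rule CM_eqI) (auto simp: adj_index)
  then have a: "adj (Id + complex_of_real h \<cdot>\<^sub>m ?K) = Id + complex_of_real h \<cdot>\<^sub>m adj ?K"
    by (simp add: adj_add adj_smult)
  have "LR (Id + complex_of_real h \<cdot>\<^sub>m ?K) (adj (Id + complex_of_real h \<cdot>\<^sub>m ?K)) =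
    proj + h *\<^sub>R (LR ?K Id + LR Id (adj ?K)) + h\<^sup>2 *\<^sub>R LR ?K (adj ?K)"
    unfolding a by (simp add: LR_add_left LR_add_right LR_smult_left LR_smult_right proj_def
        algebra_simps power2_eq_square)
  moreover have "LR ?K Id = - LR (\<i> \<cdot>\<^sub>m H) Id - (g / 2) *\<^sub>R LR W Id"
    unfolding effK_def by (subst LR_add_left) (simp_all add: LR_smult_left del: of_real_minus of_real_divide)
  moreover have "LR Id (adj ?K) = LR Id (\<i> \<cdot>\<^sub>m H) - (g / 2) *\<^sub>R LR Id W"
    unfolding adj_effK[OF H] by (subst LR_add_right) (simp_all add: LR_smult_right del: of_real_minus of_real_divide)
  ultimately show ?thesis
    by (simp add: gen_op_def damping_def ad_def algebra_simps)
qed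

text \<open>The corrected Euler steps preserve the closed cone, hence so do their powers, and these
  converge to the exponential by \<open>chernoff_limit\<close>.\<close>

lemma exp_psd_cone:
  assumes H: "hermitian_mat N H" and g: "0 \<le> g" and t: "0 \<le> t" and x: "x \<in> psd_cone"
  shows "app (exp (t *\<^sub>R gen_op H g)) x \<in> psd_cone"
proof -
  let ?Q = "LR (effK H g) (adj (effK H g))"
  \<comment> \<open>The quadratic term leaves the derivative at 0 equal to the generator.\<close>
  define F where "F h = 1 + h *\<^sub>R gen_op H g + h\<^sup>2 *\<^sub>R ?Q" for h :: real
  have HC: "H \<in> CM" using H by (simp add: hermitian_mat_def)
  have "(F has_vector_derivative gen_op H g) (at 0 within {0..})"
    unfolding F_def by (auto intro!: derivative_eq_intros)
  then have lim: "(\<lambda>k. F (t / real k) ^ k) \<longlonglongrightarrow> exp (t *\<^sub>R gen_op H g)"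
    by (rule chernoff_limit[rotated, OF _ t]) (simp add: F_def)
  have step: "app (F h) y \<in> psd_cone" if h: "0 \<le> h" and y: "y \<in> psd_cone" for h y
  proof -
    obtain A where A: "psd A" "y = emb A" using y by (auto simp: psd_cone_def)
    note AC = psd_carrier[OF A(1)]
    let ?B = "Id + complex_of_real h \<cdot>\<^sub>m effK H g"
    have "app (F h) y = emb (?B * A * adj ?B + complex_of_real (h * g) \<cdot>\<^sub>m (V_a N * A * adj (V_a N)))"
      unfolding F_def euler_step_factor[OF H] A(2) using AC HC
      by (simp add: app_proj_emb app_LR_emb emb_add emb_smult del: of_real_mult)
    moreover have "psd (?B * A * adj ?B + complex_of_real (h * g) \<cdot>\<^sub>m (V_a N * A * adj (V_a N)))"
      using h g HC A(1) by (intro psd_add psd_congruence) auto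
    ultimately show ?thesis by (auto simp: psd_cone_def)
  qed
  have mem: "app (F h ^ k) x \<in> psd_cone" if "0 \<le> h" for h k
    using x step[OF that] by (induction k) auto
  show ?thesis
    by (rule psd_cone_lim[OF _ app.tendsto[OF lim tendsto_const]]) (simp add: mem t)
qed

section \<open>Trace preservation and the closed set of density matrices\<close>

lemma mtrace_comm:
  assumes "A \<in> CM" "B \<in> CM"
  shows "mtrace (A * B) = mtrace (B * A)"
proof -
  have "mtrace (A * B) = (\<Sum>i<N. \<Sum>k<N. A $$ (i,k) * B $$ (k,i))"
    using assms by (simp add: mtrace_def mult_index del: index_mult_mat(1))
  also have "\<dots> = (\<Sum>k<N. \<Sum>i<N. B $$ (k,i) * A $$ (i,k))"
    by (subst sum.swap) (simp add: mult.commute)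
  also have "\<dots> = mtrace (B * A)"
    using assms by (simp add: mtrace_def mult_index del: index_mult_mat(1))
  finally show ?thesis .
qed

definition tr :: "mspace \<Rightarrow> complex" where "tr x = (\<Sum>i<N. apply_bcontfun x (i,i))"

lemma bounded_linear_tr: "bounded_linear tr"
  unfolding tr_def by (intro bounded_linear_sum bounded_linear_apply_mspace)

lemma tr_emb: "A \<in> CM \<Longrightarrow> tr (emb A) = mtrace A"
  by (simp add: tr_def mtrace_def emb_apply)

lemma tr_LR:
  assumes "A \<in> CM" "B \<in> CM"
  shows "tr (app (LR A B) x) = mtrace ((B * A) * unemb x)"
proof -
  have "mtrace (A * unemb x * B) = mtrace (B * (A * unemb x))"
    by (rule mtrace_comm) (use assms in auto)
  then show ?thesis using assms
    by (simp add: app_LR tr_emb assoc_mult_mat[of _ N N _ N _ N])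
qed

lemma tr_gen_op:
  assumes "H \<in> CM"
  shows "tr (app (gen_op H g) x) = 0"
proof -
  have lin: "tr (y - z) = tr y - tr z" "tr (y + z) = tr y + tr z" "tr (c *\<^sub>R y) = c *\<^sub>R tr y" for y z c
    using bounded_linear.linear[OF bounded_linear_tr]
    by (simp_all add: linear_diff linear_add linear_scale)
  have half: "(1/2) *\<^sub>R (z + z) = z" for z :: complex by (simp add: complex_eq_iff)
  show ?thesis using assms
    by (simp add: gen_op_def damping_def ad_def lin tr_LR half del: scaleR_half_double)
qed

lemma tr_exp_gen_op:
  assumes "H \<in> CM"
  shows "tr (app (exp (t *\<^sub>R gen_op H g)) x) = tr x"
proof -
  let ?y = "\<lambda>s. tr (app (exp (s *\<^sub>R gen_op H g)) x)"
  have "(?y has_vector_derivative 0) (at s)" for s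
    using bounded_linear.has_vector_derivative[OF bounded_linear_tr exp_ode_solution[of "gen_op H g" x s UNIV]]
    by (simp add: tr_gen_op[OF assms])
  then obtain c where "\<And>s. s \<in> UNIV \<Longrightarrow> ?y s = c"
    using has_vector_derivative_zero_constant[of UNIV ?y] by auto
  from this[of t] this[of 0] show ?thesis by simp
qed

lemma pos1_carrier: "A \<in> pos1 N \<Longrightarrow> A \<in> CM"
  by (simp add: pos1_iff psd_carrier)

lemma exp_pos1:
  assumes H: "hermitian_mat N H" and g: "0 \<le> g" and t: "0 \<le> t" and A: "A \<in> pos1 N"
  shows "app (exp (t *\<^sub>R gen_op H g)) (emb A) \<in> emb ` pos1 N"
proof -
  have HC: "H \<in> CM" using H by (simp add: hermitian_mat_def)
  have "emb A \<in> psd_cone" using A by (auto simp: pos1_iff psd_cone_def)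
  from exp_psd_cone[OF H g t this] obtain B where B: "psd B" "app (exp (t *\<^sub>R gen_op H g)) (emb A) = emb B"
    by (auto simp: psd_cone_def)
  have "mtrace B = mtrace A"
    using tr_exp_gen_op[OF HC, of t g "emb A"] B A by (simp add: tr_emb psd_carrier pos1_carrier)
  then show ?thesis using A B by (auto simp: pos1_iff)
qed

lemma emb_pos1_lim:
  assumes "\<And>k. x k \<in> emb ` pos1 N" "x \<longlonglongrightarrow> y"
  shows "y \<in> emb ` pos1 N"
proof -
  have x: "x k \<in> psd_cone" "tr (x k) = 1" for k
    using assms(1)[of k] by (auto simp: psd_cone_def pos1_iff tr_emb psd_carrier)
  have y: "y \<in> psd_cone" by (rule psd_cone_lim[OF x(1) assms(2)])
  have "(\<lambda>k. tr (x k)) \<longlonglongrightarrow> tr y"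
    by (rule bounded_linear.tendsto[OF bounded_linear_tr assms(2)])
  then have "tr y = 1" by (simp add: x(2) LIMSEQ_const_iff)
  with y show ?thesis by (auto simp: psd_cone_def pos1_iff tr_emb psd_carrier)
qed

lemma mat_closure_pos1: "S \<subseteq> pos1 N \<Longrightarrow> mat_closure N S \<subseteq> pos1 N"
proof
  fix A assume S: "S \<subseteq> pos1 N" and "A \<in> mat_closure N S"
  then have A: "A \<in> CM" and ex: "\<And>e. e > 0 \<Longrightarrow> \<exists>B\<in>S. \<forall>i<N. \<forall>j<N. cmod (B $$ (i,j) - A $$ (i,j)) < e"
    by (auto simp: mat_closure_def)
  have "\<exists>B\<in>S. \<forall>i<N. \<forall>j<N. cmod (B $$ (i,j) - A $$ (i,j)) < 1 / real (Suc k)" for k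
    by (rule ex) simp
  then obtain B where B: "\<And>k. B k \<in> S"
    and dB: "\<And>k i j. i < N \<Longrightarrow> j < N \<Longrightarrow> cmod (B k $$ (i,j) - A $$ (i,j)) < 1 / real (Suc k)"
    by metis
  have BC: "B k \<in> CM" for k using B S pos1_carrier by blast
  have "(\<lambda>k. emb (B k) - emb A) \<longlonglongrightarrow> 0"
  proof (rule Lim_null_comparison)
    show "\<forall>\<^sub>F k in sequentially. norm (emb (B k) - emb A) \<le> 1 / real (Suc k)"
    proof (intro always_eventually allI)
      fix k
      have "norm (emb (B k - A)) \<le> 1 / real (Suc k)"
        by (rule norm_emb_le) (use dB A BC in \<open>auto intro: less_imp_le\<close>)
      then show "norm (emb (B k) - emb A) \<le> 1 / real (Suc k)" using BC A by (simp add: emb_diff)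
    qed
    show "(\<lambda>k. 1 / real (Suc k)) \<longlonglongrightarrow> 0" using LIMSEQ_inverse_real_of_nat by (simp add: divide_inverse)
  qed
  then have "(\<lambda>k. emb (B k)) \<longlonglongrightarrow> emb A" by (rule LIM_zero_cancel)
  then have "emb A \<in> emb ` pos1 N"
    by (rule emb_pos1_lim[rotated]) (use B S in auto)
  then obtain D where "D \<in> pos1 N" "emb A = emb D" by blast
  then show "A \<in> pos1 N" using emb_inject[OF A pos1_carrier] by simp
qed

section \<open>Reachable states are density matrices\<close>

lemma H_u_hermitian:
  assumes "hermitian_mat N H0" "\<forall>H\<in>set Hs. hermitian_mat N H"
  shows "hermitian_mat N (H_u N H0 Hs u)"
proof -
  have c: "cnj (H $$ (j,i)) = H $$ (i,j)" if "hermitian_mat N H" "i < N" "j < N" for H i j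
    using that adj_index[of H i j] by (simp add: hermitian_mat_def)
  have "adj (H_u N H0 Hs u) = H_u N H0 Hs u"
    by (rule CM_eqI) (use assms in \<open>auto simp: adj_index H_u_def c cnj_sum intro!: sum.cong\<close>)
  then show ?thesis by (simp add: hermitian_mat_def)
qed

lemma reach_pos1:
  assumes "hermitian_mat N H0" "\<forall>H\<in>set Hs. hermitian_mat N H" "0 < gs" "A \<in> pos1 N"
  shows "reach N H0 Hs gs A \<subseteq> pos1 N"
proof
  fix B assume "B \<in> reach N H0 Hs gs A"
  then show "B \<in> pos1 N"
  proof induction
    case (step B C)
    from step.hyps(2)[unfolded seg_step_iff[OF pos1_carrier[OF step.IH]]]
    obtain u g t where C: "C \<in> CM" and g: "g \<in> {0, gs}" and t: "0 \<le> t"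
      and e: "emb C = app (exp (t *\<^sub>R gen_op (H_u N H0 Hs u) g)) (emb B)"
      by blast
    have g0: "0 \<le> g" using g assms(3) by auto
    have "emb C \<in> emb ` pos1 N"
      unfolding e by (rule exp_pos1[OF H_u_hermitian[OF assms(1,2)] g0 t step.IH])
    then obtain D where D: "emb C = emb D" "D \<in> pos1 N" by (rule imageE)
    then show ?case using emb_inject[OF C pos1_carrier[OF D(2)]] by simp
  qed (rule assms)
qed

lemma ad_uminus: "X \<in> CM \<Longrightarrow> ad (- X) = - ad X"
proof -
  assume X: "X \<in> CM"
  have "- X = complex_of_real (- 1) \<cdot>\<^sub>m X + 0\<^sub>m N N"
    using X by (intro eq_matI) auto
  moreover have "ad (0\<^sub>m N N) = 0"
    by (simp add: ad_def LR_def left_mult_zero_mat[of _ N N] right_mult_zero_mat[of _ N N])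
  ultimately show ?thesis using ad_lin[OF X zero_carrier_mat, of "- 1"] by simp
qed

lemma skew_uminus: "skew X \<Longrightarrow> skew (- X)"
proof -
  assume X: "skew X"
  then have XC: "X \<in> CM" by (simp add: skew_def)
  have "adj (- X) = - (- X)"
    by (rule CM_eqI) (use XC skew_index[OF X] in \<open>auto simp: adj_index\<close>)
  then show ?thesis using XC by (simp add: skew_def)
qed

lemma skew_i_hermitian:
  assumes "hermitian_mat N H" shows "skew (\<i> \<cdot>\<^sub>m H)"
proof -
  have H: "H \<in> CM" "adj H = H" using assms by (auto simp: hermitian_mat_def)
  have "adj (\<i> \<cdot>\<^sub>m H) = - (\<i> \<cdot>\<^sub>m H)"
    unfolding adj_smult[OF H(1)] H(2) by (rule CM_eqI) (use H in auto)
  then show ?thesis using H by (simp add: skew_def)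
qed

text \<open>With \<open>hs_le_norm\<close>, this compares the supremum norm on the block with the
  Hilbert-Schmidt norm, so that isometry for \<open>hs\<close> can be turned into norm
  estimates.\<close>

lemma norm_le_hs:
  assumes "app proj x = x"
  shows "norm x \<le> sqrt (hs x)"
proof -
  have "0 \<le> hs x" by (auto simp: hs_def intro!: sum_nonneg)
  then have "norm (emb (unemb x)) \<le> sqrt (hs x)"
    by (intro norm_emb_le) (auto intro: cmod_le_hs)
  then show ?thesis using assms by (simp add: app_proj)
qed

lemma hs_le_norm: "sqrt (hs x) \<le> real N * norm x"
proof (rule real_le_lsqrt)
  have "hs x \<le> (\<Sum>i<N. \<Sum>j<N. (norm x)\<^sup>2)"
    unfolding hs_def by (intro sum_mono power_mono norm_apply_le) auto
  also have "\<dots> = (real N * norm x)\<^sup>2" by (simp add: power2_eq_square)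
  finally show "hs x \<le> (real N * norm x)\<^sup>2" .
qed auto

end

locale control_system = fixed_dim N for N :: nat +
  fixes H0 :: "complex mat" and Hs :: "complex mat list" and gs :: real
  assumes H0: "hermitian_mat N H0" and Hs: "\<forall>H\<in>set Hs. hermitian_mat N H"
    and gs: "0 < gs"
    and lie: "lie_gen ((\<lambda>H. \<i> \<cdot>\<^sub>m H) ` set (H0 # Hs)) = su N"
begin

subsection \<open>The closed semigroup of reachable maps\<close>

inductive_set flows :: "sop set" where
  one: "1 \<in> flows"
| step: "T \<in> flows \<Longrightarrow> length u = length Hs \<Longrightarrow> g \<in> {0, gs} \<Longrightarrow> 0 \<le> t \<Longrightarrow>
    exp (t *\<^sub>R gen_op (H_u N H0 Hs u) g) * T \<in> flows"

abbreviation S :: "sop set" where "S \<equiv> closure flows"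

lemma flows_mult: "a \<in> flows \<Longrightarrow> b \<in> flows \<Longrightarrow> a * b \<in> flows"
  by (induction a rule: flows.induct) (auto simp: mult.assoc intro: flows.step)

sublocale semi: closed_semigroup S
proof
  show "closed S" by simp
  show "1 \<in> S" using flows.one closure_subset by blast
  fix a b assume "a \<in> S" "b \<in> S"
  then obtain f g where f: "\<And>n. f n \<in> flows" "f \<longlonglongrightarrow> a" and g: "\<And>n. g n \<in> flows" "g \<longlonglongrightarrow> b"
    unfolding closure_sequential by auto
  have "(\<lambda>n. f n * g n) \<longlonglongrightarrow> a * b" by (rule tendsto_mult[OF f(2) g(2)])
  then show "a * b \<in> S" unfolding closure_sequential
    using flows_mult[OF f(1) g(1)] by (intro exI[of _ "\<lambda>n. f n * g n"]) simp
qed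

lemma flows_reach:
  assumes "T \<in> flows" "A \<in> CM"
  shows "\<exists>B\<in>reach N H0 Hs gs A. B \<in> CM \<and> emb B = app T (emb A)"
  using assms(1)
proof induction
  case one
  then show ?case using assms(2) by (auto intro: reach.init)
next
  case (step T u g t)
  then obtain B where B: "B \<in> reach N H0 Hs gs A" "B \<in> CM" "emb B = app T (emb A)" by auto
  let ?E = "exp (t *\<^sub>R gen_op (H_u N H0 Hs u) g)"
  let ?C = "unemb (app ?E (emb B))"
  have C: "emb ?C = app ?E (emb B)"
    by (rule exp_emb) (simp_all add: gen_op_proj B)
  have "seg_step N H0 Hs gs B ?C"
    unfolding seg_step_iff[OF B(2)] using step.hyps C by auto
  then have "?C \<in> reach N H0 Hs gs A" by (rule reach.step[OF B(1)])
  moreover have "emb ?C = app (?E * T) (emb A)" using C B(3) by simp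
  ultimately show ?case using unemb_carrier by blast
qed

lemma gen_op_wedge:
  assumes "length u = length Hs" "g \<in> {0, gs}"
  shows "gen_op (H_u N H0 Hs u) g \<in> wedge S"
  unfolding wedge_def
proof (intro CollectI allI impI)
  fix t :: real assume "0 \<le> t"
  from flows.step[OF flows.one assms this]
  show "exp (t *\<^sub>R gen_op (H_u N H0 Hs u) g) \<in> S" using closure_subset by auto
qed

text \<open>\<open>gen_op\<close> contains \<open>- ad\<close>, so what the controls provide is
  \<open>ad (- X)\<close>; recurrence is applied to \<open>- X\<close>.\<close>

lemma ad_wedge_uminus:
  assumes "skew X" "- ad X \<in> wedge S"
  shows "ad X \<in> wedge S"
proof -
  have "X \<in> CM" using assms by (simp add: skew_def)
  then have "- ad (- X) \<in> wedge S"
    using assms by (intro recurrent_ad semi.closed_semigroup_axioms skew_uminus) (simp_all add: ad_uminus)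
  then show ?thesis using \<open>X \<in> CM\<close> by (simp add: ad_uminus)
qed

text \<open>The pullback of the lineality space of the wedge along \<open>ad\<close>: a set of
  matrices, so that it can be compared with \<open>lie_gen\<close>.\<close>

definition edge :: "complex mat set" where
  "edge = {X \<in> CM. ad X \<in> wedge S \<and> - ad X \<in> wedge S}"

lemma H_u_edge:
  assumes "length u = length Hs"
  shows "\<i> \<cdot>\<^sub>m H_u N H0 Hs u \<in> edge"
proof -
  have "- ad (\<i> \<cdot>\<^sub>m H_u N H0 Hs u) \<in> wedge S"
    using gen_op_wedge[OF assms, of 0] by (simp add: gen_op_def)
  then show ?thesis
    using ad_wedge_uminus[OF skew_i_hermitian[OF H_u_hermitian[OF H0 Hs]]] by (simp add: edge_def)
qed

lemma edge_lin:
  assumes "X \<in> edge" "Y \<in> edge"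
  shows "complex_of_real a \<cdot>\<^sub>m X + Y \<in> edge"
proof -
  have C: "X \<in> CM" "Y \<in> CM" using assms by (auto simp: edge_def)
  have m: "a *\<^sub>R Z \<in> wedge S" if "Z \<in> wedge S" "- Z \<in> wedge S" for Z a
    using semi.wedge_scaleR[OF that(1), of a] semi.wedge_scaleR[OF that(2), of "- a"] by (cases "0 \<le> a") auto
  have "a *\<^sub>R ad X + ad Y \<in> wedge S"
    using assms by (intro semi.wedge_add m) (auto simp: edge_def)
  moreover have "(- a) *\<^sub>R ad X + - ad Y \<in> wedge S"
    using assms by (intro semi.wedge_add m) (auto simp: edge_def)
  ultimately show ?thesis using C by (simp add: edge_def ad_lin)
qed

lemma edge_bracket:
  assumes "X \<in> edge" "Y \<in> edge"
  shows "X * Y - Y * X \<in> edge"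
proof -
  have C: "X \<in> CM" "Y \<in> CM" using assms by (auto simp: edge_def)
  have "ad X * ad Y - ad Y * ad X \<in> wedge S" "ad Y * ad X - ad X * ad Y \<in> wedge S"
    using assms by (auto simp: edge_def intro: semi.wedge_bracket)
  then show ?thesis using C by (simp add: edge_def ad_bracket)
qed

lemma H_u_zero: "H_u N H0 Hs (replicate (length Hs) 0) = H0"
  by (rule CM_eqI) (use H0 in \<open>auto simp: H_u_def hermitian_mat_def\<close>)

lemma H_u_unit:
  assumes "k < length Hs"
  shows "H_u N H0 Hs ((replicate (length Hs) 0)[k := 1]) = H0 + Hs ! k"
proof (rule CM_eqI)
  have k: "Hs ! k \<in> CM" using Hs assms by (auto simp: hermitian_mat_def)
  then show "H0 + Hs ! k \<in> CM" by simp
  fix i j assume ij: "i < N" "j < N"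
  have "(\<Sum>l<length Hs. complex_of_real ((replicate (length Hs) 0)[k := 1] ! l) * Hs ! l $$ (i,j)) =
    (\<Sum>l<length Hs. if l = k then Hs ! k $$ (i,j) else 0)"
    by (intro sum.cong) (auto simp: nth_list_update)
  then show "H_u N H0 Hs ((replicate (length Hs) 0)[k := 1]) $$ (i,j) = (H0 + Hs ! k) $$ (i,j)"
    using ij k assms by (simp add: H_u_def)
qed simp

text \<open>The zero control and the unit controls give \<open>i H0\<close> and
  \<open>i (H0 + H_k)\<close>. Differences isolate \<open>i H_k\<close>, and closure under linear
  combinations and brackets carries the induction over \<open>lie_gen\<close>.\<close>

lemma su_edge: "su N \<subseteq> edge"
proof -
  have H0C: "H0 \<in> CM" using H0 by (simp add: hermitian_mat_def)
  have iH0: "\<i> \<cdot>\<^sub>m H0 \<in> edge"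
    using H_u_edge[of "replicate (length Hs) 0"] by (simp add: H_u_zero)
  have iH: "\<i> \<cdot>\<^sub>m (Hs ! k) \<in> edge" if k: "k < length Hs" for k
  proof -
    have kC: "Hs ! k \<in> CM" using Hs k by (auto simp: hermitian_mat_def)
    have "\<i> \<cdot>\<^sub>m (H0 + Hs ! k) \<in> edge"
      using H_u_edge[of "(replicate (length Hs) 0)[k := 1]"] by (simp add: H_u_unit[OF k])
    from edge_lin[OF iH0 this, of "- 1"]
    have "complex_of_real (- 1) \<cdot>\<^sub>m (\<i> \<cdot>\<^sub>m H0) + \<i> \<cdot>\<^sub>m (H0 + Hs ! k) \<in> edge" .
    moreover have "complex_of_real (- 1) \<cdot>\<^sub>m (\<i> \<cdot>\<^sub>m H0) + \<i> \<cdot>\<^sub>m (H0 + Hs ! k) = \<i> \<cdot>\<^sub>m (Hs ! k)"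
      by (rule CM_eqI) (use H0C kC in \<open>auto simp: algebra_simps\<close>)
    ultimately show ?thesis by simp
  qed
  have "X \<in> edge" if "X \<in> lie_gen ((\<lambda>H. \<i> \<cdot>\<^sub>m H) ` set (H0 # Hs))" for X
    using that
  proof induction
    case (gen X)
    then show ?case using iH0 iH by (auto simp: in_set_conv_nth)
  qed (auto intro: edge_lin edge_bracket)
  then show ?thesis using lie by auto
qed

lemma damping_wedge: "damping \<in> wedge S"
proof -
  have "gen_op H0 gs \<in> wedge S"
    using gen_op_wedge[of "replicate (length Hs) 0" gs] by (simp add: H_u_zero)
  moreover have "ad (\<i> \<cdot>\<^sub>m H0) \<in> wedge S"
    using H_u_edge[of "replicate (length Hs) 0"] by (simp add: H_u_zero edge_def)
  ultimately have "gen_op H0 gs + ad (\<i> \<cdot>\<^sub>m H0) \<in> wedge S" by (rule semi.wedge_add)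
  then have "gs *\<^sub>R damping \<in> wedge S" by (simp add: gen_op_def)
  \<comment> \<open>The wedge is a cone, so one fixed noise amplitude yields the generator at every
    amplitude.\<close>
  then have "(1 / gs) *\<^sub>R (gs *\<^sub>R damping) \<in> wedge S"
    by (rule semi.wedge_scaleR) (use gs in simp)
  then show ?thesis using gs by simp
qed

subsection \<open>Approximate accessibility\<close>

text \<open>\<open>S\<close> is closed, but the set of values \<open>app T x\<close> for T in
  \<open>S\<close> is not shown to be. The tolerance e makes the relation stable under limits of y
  while \<open>acc_trans\<close> keeps it transitive.\<close>

definition acc :: "mspace \<Rightarrow> mspace \<Rightarrow> bool" where
  "acc x y \<longleftrightarrow> (\<forall>e>0. \<exists>T\<in>S. norm (app T x - y) < e)"

lemma acc_app: "T \<in> S \<Longrightarrow> acc x (app T x)"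
  unfolding acc_def by (intro allI impI bexI[of _ T]) auto

lemma acc_refl: "acc x x"
  using acc_app[OF semi.one, of x] by simp

lemma acc_trans:
  assumes "acc x y" "acc y z"
  shows "acc x z"
  unfolding acc_def
proof (intro allI impI)
  fix e :: real assume e: "0 < e"
  obtain T where T: "T \<in> S" "norm (app T y - z) < e / 2"
    using assms(2) e unfolding acc_def by (meson half_gt_zero)
  \<comment> \<open>T magnifies errors by at most its norm, so this d costs at most e / 2; the
    summand 1 guards against a vanishing norm.\<close>
  define d where "d = e / (2 * (norm T + 1))"
  have n: "0 < norm T + 1" by (rule add_nonneg_pos) auto
  then have "0 < d" using e by (simp add: d_def)
  then obtain R where R: "R \<in> S" "norm (app R x - y) < d"
    using assms(1) unfolding acc_def by blast
  have "norm (app (T * R) x - z) = norm (app T (app R x - y) + (app T y - z))" by simp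
  also have "\<dots> \<le> norm T * norm (app R x - y) + norm (app T y - z)"
    by (intro norm_triangle_le add_mono norm_app order_refl)
  also have "\<dots> < (norm T + 1) * d + e / 2"
    using R(2) T(2) by (intro add_le_less_mono mult_mono) auto
  also have "(norm T + 1) * d = e / 2" using n by (simp add: d_def field_simps)
  finally have "norm (app (T * R) x - z) < e" by simp
  then show "\<exists>T\<in>S. norm (app T x - z) < e" using semi.mult[OF T(1) R(1)] by (rule bexI)
qed

lemma acc_lim:
  assumes acc: "\<And>k. acc x (y k)" and lim: "y \<longlonglongrightarrow> z"
  shows "acc x z"
  unfolding acc_def
proof (intro allI impI)
  fix e :: real assume "0 < e"
  then have e: "0 < e / 2" by simp
  from LIMSEQ_D[OF lim e] obtain k where k: "norm (y k - z) < e / 2" by auto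
  obtain T where T: "T \<in> S" "norm (app T x - y k) < e / 2"
    using acc[of k] e unfolding acc_def by blast
  have "norm (app T x - z) \<le> norm (app T x - y k) + norm (y k - z)"
    using norm_triangle_ineq[of "app T x - y k" "y k - z"] by simp
  also have "\<dots> < e" using k T(2) by simp
  finally show "\<exists>T\<in>S. norm (app T x - z) < e" using T(1) by auto
qed

text \<open>Reachable matrices come from \<open>flows\<close>, whereas \<open>acc\<close> speaks
  about the closure \<open>S\<close>. So T is first replaced by a nearby flow R, at a cost
  proportional to the norm of \<open>emb A\<close>; the supremum norm then controls every
  entry.\<close>

lemma acc_mat_closure:
  assumes A: "A \<in> CM" and B: "B \<in> CM" and acc: "acc (emb A) (emb B)"
  shows "B \<in> mat_closure N (reach N H0 Hs gs A)"
  unfolding mat_closure_def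
proof (intro CollectI conjI B allI impI)
  fix e :: real assume e: "0 < e"
  then obtain T where T: "T \<in> S" "norm (app T (emb A) - emb B) < e / 2"
    using acc unfolding acc_def by (meson half_gt_zero)
  define d where "d = e / (2 * (norm (emb A) + 1))"
  have n: "0 < norm (emb A) + 1" by (rule add_nonneg_pos) auto
  then have "0 < d" using e by (simp add: d_def)
  then obtain R where R: "R \<in> flows" "norm (R - T) < d"
    using T(1) unfolding closure_approachable dist_norm by blast
  obtain C where C: "C \<in> reach N H0 Hs gs A" "C \<in> CM" "emb C = app R (emb A)"
    using flows_reach[OF R(1) A] by blast
  have "norm (emb C - emb B) = norm (app (R - T) (emb A) + (app T (emb A) - emb B))" using C by simp
  also have "\<dots> \<le> norm (R - T) * norm (emb A) + norm (app T (emb A) - emb B)"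
    by (intro norm_triangle_le add_mono norm_app order_refl)
  also have "\<dots> < d * (norm (emb A) + 1) + e / 2"
    using R(2) T(2) \<open>0 < d\<close> by (intro add_le_less_mono mult_mono) (auto intro: less_imp_le)
  also have "d * (norm (emb A) + 1) = e / 2" using n by (simp add: d_def field_simps)
  finally have lt: "norm (emb C - emb B) < e" by simp
  have "cmod (C $$ (i,j) - B $$ (i,j)) < e" if "i < N" "j < N" for i j
    using norm_apply_le[of "emb C - emb B" "(i,j)"] lt that by (simp add: emb_apply)
  then show "\<exists>C\<in>reach N H0 Hs gs A. \<forall>i<N. \<forall>j<N. cmod (C $$ (i,j) - B $$ (i,j)) < e"
    using C(1) by blast
qed

lemma S_pos1:
  assumes T: "T \<in> S" and A: "A \<in> pos1 N"
  shows "app T (emb A) \<in> emb ` pos1 N"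
proof -
  have fl: "app R (emb A) \<in> emb ` pos1 N" if R: "R \<in> flows" for R
  proof -
    obtain B where B: "B \<in> reach N H0 Hs gs A" "emb B = app R (emb A)"
      using flows_reach[OF R pos1_carrier[OF A]] by blast
    then show ?thesis using reach_pos1[OF H0 Hs gs A] by (metis image_eqI subsetD)
  qed
  obtain f where f: "\<And>n. f n \<in> flows" "f \<longlonglongrightarrow> T"
    using T unfolding closure_sequential by auto
  show ?thesis
    by (rule emb_pos1_lim[OF fl[OF f(1)] app.tendsto[OF f(2) tendsto_const]])
qed

subsection \<open>Orbits under the reversible part\<close>

text \<open>Stands in for conjugation by unitaries. A map is recorded through what later arguments
  use: a left inverse inside \<open>S\<close> that respects the block and is isometric for
  \<open>hs\<close>.\<close>

definition rev_maps :: "sop set" where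
  "rev_maps = {T \<in> S. \<exists>T'\<in>S. T' * T = 1 \<and> T' * proj = proj * T' \<and> (\<forall>x. hs (app T' x) = hs x)}"

lemma rev_maps_one: "1 \<in> rev_maps"
  using semi.one by (auto simp: rev_maps_def intro!: bexI[of _ 1])

lemma rev_maps_mult:
  assumes "a \<in> rev_maps" "b \<in> rev_maps"
  shows "a * b \<in> rev_maps"
proof -
  obtain a' b' where a: "a \<in> S" "a' \<in> S" "a' * a = 1" "a' * proj = proj * a'" "\<And>x. hs (app a' x) = hs x"
    and b: "b \<in> S" "b' \<in> S" "b' * b = 1" "b' * proj = proj * b'" "\<And>x. hs (app b' x) = hs x"
    using assms by (auto simp: rev_maps_def)
  have "(b' * a') * (a * b) = b' * (a' * a) * b" by (simp only: mult.assoc)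
  also have "\<dots> = 1" by (simp add: a b)
  finally have 1: "(b' * a') * (a * b) = 1" .
  have 2: "(b' * a') * proj = proj * (b' * a')"
    using a(4) b(4) by (metis mult.assoc)
  show ?thesis unfolding rev_maps_def
    using 1 2 semi.mult[OF a(1) b(1)] semi.mult[OF b(2) a(2)] a(5) b(5)
    by (intro CollectI conjI bexI[of _ "b' * a'"]) auto
qed

lemma exp_ad_rev_maps:
  assumes X: "X \<in> su N"
  shows "exp (t *\<^sub>R ad X) \<in> rev_maps"
proof -
  have sk: "skew X" using X by (simp add: su_def skew_def)
  then have XC: "X \<in> CM" by (simp add: skew_def)
  have e: "ad X \<in> wedge S" "- ad X \<in> wedge S" using su_edge X by (auto simp: edge_def)
  have mem: "exp (s *\<^sub>R ad X) \<in> S" for s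
  proof (cases "0 \<le> s")
    case True
    then show ?thesis using e(1) by (simp add: wedge_def)
  next
    case False
    then have "exp ((- s) *\<^sub>R (- ad X)) \<in> S" using e(2) unfolding wedge_def by (auto simp del: scaleR_minus_left scaleR_minus_right)
    then show ?thesis by simp
  qed
  have "exp ((- t) *\<^sub>R ad X) * exp (t *\<^sub>R ad X) = 1" by simp
  then show ?thesis unfolding rev_maps_def
    using mem[of t] mem[of "- t"] exp_proj_commute[OF ad_proj[OF XC], of "- t"] hs_exp_ad[OF sk, of "- t"]
    by blast
qed

definition orbit :: "mspace \<Rightarrow> mspace set" where
  "orbit x = closure ((\<lambda>T. app T x) ` rev_maps)"

lemma orbit_sequence:
  assumes "y \<in> orbit x"
  shows "\<exists>T. (\<forall>n. T n \<in> rev_maps) \<and> (\<lambda>n. app (T n) x) \<longlonglongrightarrow> y"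
proof -
  obtain f where f: "\<And>n. f n \<in> (\<lambda>T. app T x) ` rev_maps" "f \<longlonglongrightarrow> y"
    using assms unfolding orbit_def closure_sequential by auto
  then have "\<forall>n. \<exists>T. T \<in> rev_maps \<and> f n = app T x" by blast
  then obtain T where T: "\<And>n. T n \<in> rev_maps" "\<And>n. f n = app (T n) x" by metis
  then have "f = (\<lambda>n. app (T n) x)" by auto
  then show ?thesis using T(1) f(2) by auto
qed

lemma orbit_invariant:
  assumes "R \<in> rev_maps" "y \<in> orbit x"
  shows "app R y \<in> orbit x"
proof -
  obtain T where T: "\<And>n. T n \<in> rev_maps" "(\<lambda>n. app (T n) x) \<longlonglongrightarrow> y"
    using orbit_sequence[OF assms(2)] by auto
  have "(\<lambda>n. app R (app (T n) x)) \<longlonglongrightarrow> app R y"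
    by (rule app.tendsto[OF tendsto_const T(2)])
  moreover have "app R (app (T n) x) \<in> (\<lambda>T. app T x) ` rev_maps" for n
    using rev_maps_mult[OF assms(1) T(1), of n] by (auto simp: image_iff intro!: bexI[of _ "R * T n"])
  ultimately show ?thesis unfolding orbit_def closure_sequential
    by (intro exI[of _ "\<lambda>n. app R (app (T n) x)"]) simp
qed

lemma rev_maps_S: "T \<in> rev_maps \<Longrightarrow> T \<in> S"
  by (simp add: rev_maps_def)

lemma orbit_acc:
  assumes "y \<in> orbit x" shows "acc x y"
proof -
  obtain T where T: "\<And>n. T n \<in> rev_maps" "(\<lambda>n. app (T n) x) \<longlonglongrightarrow> y"
    using orbit_sequence[OF assms] by auto
  show ?thesis by (rule acc_lim[OF acc_app[OF rev_maps_S[OF T(1)]] T(2)])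
qed

text \<open>If \<open>T n x\<close> tends to y, the inverses satisfy
  \<open>T' n y - x = T' n (y - T n x)\<close>. They are isometric for \<open>hs\<close>, so these
  differences tend to 0 although the maps \<open>T' n\<close> themselves need not converge.\<close>

lemma orbit_acc_back:
  assumes y: "y \<in> orbit x" and py: "app proj y = y" and px: "app proj x = x"
  shows "acc y x"
proof -
  obtain T where T: "\<And>n. T n \<in> rev_maps" "(\<lambda>n. app (T n) x) \<longlonglongrightarrow> y"
    using orbit_sequence[OF y] by auto
  have "\<forall>n. \<exists>T'. T' \<in> S \<and> T' * T n = 1 \<and> T' * proj = proj * T' \<and> (\<forall>x. hs (app T' x) = hs x)"
    using T(1) unfolding rev_maps_def by blast
  then obtain T' where T': "\<And>n. T' n \<in> S" "\<And>n. T' n * T n = 1"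
    "\<And>n. T' n * proj = proj * T' n" "\<And>n x. hs (app (T' n) x) = hs x" by metis
  have inv: "app (T' n) (app (T n) x) = x" for n
    using T'(2)[of n] by (metis app_mult app_one)
  have bd: "norm (app (T' n) y - x) \<le> real N * norm (y - app (T n) x)" for n
  proof -
    define d where "d = app (T' n) y - x"
    have "app proj (app (T' n) y) = app (T' n) y"
      using T'(3)[of n] py by (metis app_mult)
    then have "app proj d = d" by (simp add: d_def px)
    then have "norm d \<le> sqrt (hs d)" by (rule norm_le_hs)
    also have "d = app (T' n) (y - app (T n) x)" by (simp add: d_def inv)
    also have "sqrt (hs \<dots>) \<le> real N * norm (y - app (T n) x)"
      unfolding T'(4) by (rule hs_le_norm)
    finally show ?thesis by (simp add: d_def inv)
  qed
  have "(\<lambda>n. real N * norm (y - app (T n) x)) \<longlonglongrightarrow> real N * norm (y - y)"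
    by (intro tendsto_intros T(2))
  then have "(\<lambda>n. real N * norm (y - app (T n) x)) \<longlonglongrightarrow> 0" by simp
  then have "(\<lambda>n. app (T' n) y - x) \<longlonglongrightarrow> 0"
    by (rule Lim_null_comparison[rotated]) (simp add: bd)
  then have "(\<lambda>n. app (T' n) y) \<longlonglongrightarrow> x" by (rule LIM_zero_cancel)
  then show ?thesis by (rule acc_lim[OF acc_app[OF T'(1)]])
qed

lemma orbit_pos1:
  assumes "A \<in> pos1 N" "y \<in> orbit (emb A)"
  shows "y \<in> emb ` pos1 N"
proof -
  obtain T where T: "\<And>n. T n \<in> rev_maps" "(\<lambda>n. app (T n) (emb A)) \<longlonglongrightarrow> y"
    using orbit_sequence[OF assms(2)] by auto
  show ?thesis by (rule emb_pos1_lim[OF S_pos1[OF rev_maps_S[OF T(1)] assms(1)] T(2)])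
qed

text \<open>The isometric left inverse returns an image point to \<open>emb A\<close>, so all image
  points share its value of \<open>hs\<close>. Their coordinates are bounded and they lie in one
  compact set.\<close>

lemma compact_orbit:
  assumes A: "A \<in> pos1 N"
  shows "compact (orbit (emb A))"
proof -
  let ?x = "emb A"
  let ?f = "\<lambda>c. 0 + (\<Sum>a\<in>ix. c a *\<^sub>R basis a)"
  let ?C = "sqrt (hs ?x)"
  let ?K = "?f ` PiE UNIV (\<lambda>_. {- ?C..?C})"
  have K: "compact ?K" by (rule compact_linear_combinations)
  have "(\<lambda>T. app T ?x) ` rev_maps \<subseteq> ?K"
  proof
    fix y assume "y \<in> (\<lambda>T. app T ?x) ` rev_maps"
    then obtain T where T: "T \<in> rev_maps" "y = app T ?x" by blast
    obtain B where B: "B \<in> pos1 N" "y = emb B" using S_pos1[OF rev_maps_S[OF T(1)] A] T(2) by blast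
    have py: "app proj y = y" using B by (simp add: app_proj_emb pos1_carrier)
    obtain T' where T': "T' * T = 1" "\<And>x. hs (app T' x) = hs x" using T(1) by (auto simp: rev_maps_def)
    have "app T' y = ?x" using T'(1) T(2) by (metis app_mult app_one)
    then have hy: "hs y = hs ?x" using T'(2)[of y] by simp
    define c where "c a = (if a \<in> ix then coord a y else 0)" for a
    have "0 \<le> ?C" by (auto simp: hs_def intro!: sum_nonneg)
    moreover have "- ?C \<le> coord a y \<and> coord a y \<le> ?C" if "a \<in> ix" for a
      using abs_coord_le[OF that, of y] unfolding hy by (simp add: abs_le_iff minus_le_iff)
    ultimately have "c \<in> PiE UNIV (\<lambda>_. {- ?C..?C})" by (auto simp: c_def)
    moreover have "y = ?f c"
      using py unfolding app_proj_coord by (simp add: c_def cong: sum.cong)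
    ultimately show "y \<in> ?K" by blast
  qed
  then have "orbit ?x \<subseteq> ?K"
    unfolding orbit_def by (rule closure_minimal[OF _ compact_imp_closed[OF K]])
  then have "orbit ?x = ?K \<inter> orbit ?x" by blast
  moreover have "compact (?K \<inter> orbit ?x)"
    by (rule compact_Int_closed[OF K]) (simp add: orbit_def)
  ultimately show ?thesis by simp
qed

subsection \<open>Plane rotations\<close>

lemma uminus_mult_CM:
  assumes "A \<in> CM" "B \<in> CM"
  shows "- A * B = - (A * B)" "A * - B = - (A * B)"
  using assms
  by (auto intro!: CM_eqI simp: mult_index sum_negf simp del: index_mult_mat(1))

definition rotX :: "nat \<Rightarrow> nat \<Rightarrow> complex \<Rightarrow> complex mat" where
  "rotX i j z = mat N N (\<lambda>(k,l). if k = i \<and> l = j then z else if k = j \<and> l = i then - cnj z else 0)"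

lemma rotX_carrier [simp]: "rotX i j z \<in> CM"
  by (simp add: rotX_def)

lemma rotX_left:
  assumes "i < N" "j < N" "i \<noteq> j" "M \<in> CM" "k < N" "l < N"
  shows "(rotX i j z * M) $$ (k,l) =
    (if k = i then z * M $$ (j,l) else if k = j then - (cnj z * M $$ (i,l)) else 0)"
proof -
  have "(rotX i j z * M) $$ (k,l) = (\<Sum>m<N. if m = (if k = i then j else i) then
      (if k = i then z else if k = j then - cnj z else 0) * M $$ (m,l) else 0)"
    unfolding mult_index[OF rotX_carrier assms(4-6)]
    using assms by (intro sum.cong) (auto simp: rotX_def)
  also have "\<dots> = (if k = i then z * M $$ (j,l) else if k = j then - (cnj z * M $$ (i,l)) else 0)"
    using assms by (subst sum.delta) auto
  finally show ?thesis .
qed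

lemma rotX_right:
  assumes "i < N" "j < N" "i \<noteq> j" "M \<in> CM" "k < N" "l < N"
  shows "(M * rotX i j z) $$ (k,l) =
    (if l = j then M $$ (k,i) * z else if l = i then - (M $$ (k,j) * cnj z) else 0)"
proof -
  have "(M * rotX i j z) $$ (k,l) = (\<Sum>m<N. if m = (if l = j then i else j) then
      M $$ (k,m) * (if l = j then z else if l = i then - cnj z else 0) else 0)"
    unfolding mult_index[OF assms(4) rotX_carrier assms(5,6)]
    using assms by (intro sum.cong) (auto simp: rotX_def)
  also have "\<dots> = (if l = j then M $$ (k,i) * z else if l = i then - (M $$ (k,j) * cnj z) else 0)"
    using assms by (subst sum.delta) auto
  finally show ?thesis .
qed

lemma rotX_su:
  assumes "i < N" "j < N" "i \<noteq> j"
  shows "rotX i j z \<in> su N"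
proof -
  have "adj (rotX i j z) = - rotX i j z"
    by (rule CM_eqI) (use assms in \<open>auto simp: adj_index rotX_def\<close>)
  moreover have "mtrace (rotX i j z) = 0"
    using assms by (auto simp: mtrace_def rotX_def intro!: sum.neutral)
  ultimately show ?thesis by (simp add: su_def)
qed

text \<open>For |z| = 1 the square of \<open>rotX i j z\<close> is minus the projection onto the
  plane of coordinates i and j, and \<open>rotX i j z\<close> maps into that plane.\<close>

lemma rotX_cube:
  assumes ij: "i < N" "j < N" "i \<noteq> j" and z: "z * cnj z = 1"
  shows "rotX i j z * (rotX i j z * rotX i j z) = - rotX i j z"
proof (rule CM_eqI)
  fix k l assume kl: "k < N" "l < N"
  have zz: "z * (cnj z * w) = w" "cnj z * (z * w) = w" for w
    using z by (simp_all add: mult.assoc[symmetric] mult.commute[of "cnj z"])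
  show "(rotX i j z * (rotX i j z * rotX i j z)) $$ (k,l) = (- rotX i j z) $$ (k,l)"
    using ij kl by (simp add: rotX_left zz del: index_mult_mat(1)) (auto simp: rotX_def zz)
qed auto

text \<open>Left multiplication by the rotation U = exp (t X) with X = \<open>rotX i j z\<close>;
  \<open>col_rot\<close> is right multiplication by U^dagger.\<close>

definition row_rot :: "nat \<Rightarrow> nat \<Rightarrow> complex \<Rightarrow> real \<Rightarrow> complex mat \<Rightarrow> complex mat" where
  "row_rot i j z t M = mat N N (\<lambda>(k,l).
     if k = i then complex_of_real (cos t) * M $$ (i,l) + complex_of_real (sin t) * z * M $$ (j,l)
     else if k = j then complex_of_real (cos t) * M $$ (j,l) - complex_of_real (sin t) * cnj z * M $$ (i,l)
     else M $$ (k,l))"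

definition col_rot :: "nat \<Rightarrow> nat \<Rightarrow> complex \<Rightarrow> real \<Rightarrow> complex mat \<Rightarrow> complex mat" where
  "col_rot i j z t M = mat N N (\<lambda>(k,l).
     if l = i then complex_of_real (cos t) * M $$ (k,i) + complex_of_real (sin t) * cnj z * M $$ (k,j)
     else if l = j then complex_of_real (cos t) * M $$ (k,j) - complex_of_real (sin t) * z * M $$ (k,i)
     else M $$ (k,l))"

lemma exp_LX:
  assumes ij: "i < N" "j < N" "i \<noteq> j" and z: "z * cnj z = 1" and M: "M \<in> CM"
  shows "app (exp (t *\<^sub>R LR (rotX i j z) Id)) (emb M) = emb (row_rot i j z t M)"
proof -
  let ?X = "rotX i j z"
  have zz: "z * (cnj z * w) = w" "cnj z * (z * w) = w" for w
    using z by (simp_all add: mult.assoc[symmetric] mult.commute[of "cnj z"])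
  have "LR ?X Id * LR ?X Id * LR ?X Id = LR (?X * (?X * ?X)) Id"
    by (simp add: LR_mult assoc_mult_mat[of _ N N _ N _ N])
  also have "\<dots> = - LR ?X Id"
    unfolding rotX_cube[OF ij z]
    by (rule sop_eqI) (simp add: app_LR emb_uminus uminus_mult_CM)
  finally have "app (exp (t *\<^sub>R LR ?X Id)) (emb M) =
      emb M + sin t *\<^sub>R emb (?X * M) + (1 - cos t) *\<^sub>R emb (?X * (?X * M))"
    using M by (simp add: exp_scaleR_rotation app_LR_emb)
  also have "\<dots> = emb (row_rot i j z t M)"
  proof (rule mspace_eqI)
    fix k l
    show "apply_bcontfun (emb M + sin t *\<^sub>R emb (?X * M) + (1 - cos t) *\<^sub>R emb (?X * (?X * M))) (k,l) =
      apply_bcontfun (emb (row_rot i j z t M)) (k,l)"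
    proof (cases "k < N \<and> l < N")
      case True
      then show ?thesis using ij M
        by (simp add: emb_apply rotX_left zz del: index_mult_mat(1))
          (auto simp: row_rot_def scaleR_conv_of_real algebra_simps zz)
    qed (auto simp: emb_apply)
  qed
  finally show ?thesis .
qed

lemma exp_RX:
  assumes ij: "i < N" "j < N" "i \<noteq> j" and z: "z * cnj z = 1" and M: "M \<in> CM"
  shows "app (exp (t *\<^sub>R (- LR Id (rotX i j z)))) (emb M) = emb (col_rot i j z t M)"
proof -
  let ?X = "rotX i j z"
  have zz: "w * (z * cnj z) = w" for w
    using z by simp
  have "LR Id ?X * LR Id ?X * LR Id ?X = LR Id (?X * (?X * ?X))"
    by (simp add: LR_mult assoc_mult_mat[of _ N N _ N _ N])
  also have "\<dots> = - LR Id ?X"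
    unfolding rotX_cube[OF ij z]
    by (rule sop_eqI) (simp add: app_LR emb_uminus uminus_mult_CM)
  finally have "(- LR Id ?X) * (- LR Id ?X) * (- LR Id ?X) = - (- LR Id ?X)" by simp
  from exp_scaleR_rotation[OF this, of t]
  have "app (exp (t *\<^sub>R (- LR Id ?X))) (emb M) =
      emb M - sin t *\<^sub>R emb (M * ?X) + (1 - cos t) *\<^sub>R emb (M * ?X * ?X)"
    using M by (simp add: app_LR_emb)
  also have "\<dots> = emb (col_rot i j z t M)"
  proof (rule mspace_eqI)
    fix k l
    show "apply_bcontfun (emb M - sin t *\<^sub>R emb (M * ?X) + (1 - cos t) *\<^sub>R emb (M * ?X * ?X)) (k,l) =
      apply_bcontfun (emb (col_rot i j z t M)) (k,l)"
    proof (cases "k < N \<and> l < N")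
      case True
      have zz': "M $$ (k,m) * z * cnj z = M $$ (k,m)" "M $$ (k,m) * cnj z * z = M $$ (k,m)" for m
        using z by (simp_all add: mult.assoc mult.commute[of "cnj z"])
      from True show ?thesis using ij M
        by (simp add: emb_apply rotX_right zz' del: index_mult_mat(1))
          (auto simp: col_rot_def scaleR_conv_of_real algebra_simps zz')
    qed (auto simp: emb_apply)
  qed
  finally show ?thesis .
qed

lemma row_rot_carrier [simp]: "row_rot i j z t M \<in> CM"
  by (simp add: row_rot_def)

text \<open>Left and right multiplications commute, so the exponential of \<open>ad\<close> splits
  into a row rotation followed by a column rotation.\<close>

lemma exp_ad_rotX:
  assumes ij: "i < N" "j < N" "i \<noteq> j" and z: "z * cnj z = 1" and M: "M \<in> CM"
  shows "app (exp (t *\<^sub>R ad (rotX i j z))) (emb M) = emb (col_rot i j z t (row_rot i j z t M))"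
proof -
  let ?X = "rotX i j z"
  have "t *\<^sub>R ad ?X = t *\<^sub>R (- LR Id ?X) + t *\<^sub>R LR ?X Id"
    by (simp add: ad_def algebra_simps)
  moreover have "(t *\<^sub>R (- LR Id ?X)) * (t *\<^sub>R LR ?X Id) = (t *\<^sub>R LR ?X Id) * (t *\<^sub>R (- LR Id ?X))"
    by (simp add: LR_mult)
  ultimately have "exp (t *\<^sub>R ad ?X) = exp (t *\<^sub>R (- LR Id ?X)) * exp (t *\<^sub>R LR ?X Id)"
    using exp_add_commuting by metis
  then show ?thesis
    using exp_LX[OF ij z M] exp_RX[OF ij z row_rot_carrier] by simp
qed

definition diag_weight :: "mspace \<Rightarrow> real" where
  "diag_weight x = (\<Sum>k<N. (Re (apply_bcontfun x (k,k)))\<^sup>2)"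

lemma sum_split_two:
  fixes f :: "nat \<Rightarrow> real"
  assumes "i < N" "j < N" "i \<noteq> j"
  shows "(\<Sum>k<N. f k) = (\<Sum>k\<in>{..<N} - {i,j}. f k) + (f i + f j)"
  using sum.subset_diff[of "{i,j}" "{..<N}" f] assms by simp

text \<open>A Jacobi rotation annihilating an off-diagonal entry \<open>c\<close> increases the sum of the squared
  diagonal entries by \<open>2 |c|^2\<close>.\<close>
lemma jacobi_increase:
  assumes ij: "i < N" "j < N" "i \<noteq> j" and M: "hermitian_mat N M" and nz: "M $$ (i,j) \<noteq> 0"
  obtains t z where "z * cnj z = 1"
    "diag_weight (emb M) < diag_weight (app (exp (t *\<^sub>R ad (rotX i j z))) (emb M))"
proof -
  have MC: "M \<in> CM" "adj M = M" using M by (auto simp: hermitian_mat_def)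
  have Mji: "M $$ (j,i) = cnj (M $$ (i,j))" using adj_index[OF MC(1), of j i] MC(2) ij by simp
  define r where "r = cmod (M $$ (i,j))"
  \<comment> \<open>The phase of the entry. Absorbing it in the rotation reduces the 2 x 2 block to
    the real symmetric matrix with diagonal a, b and off-diagonal r.\<close>
  define z where "z = M $$ (i,j) / complex_of_real r"
  have r: "r > 0" using nz by (simp add: r_def)
  have Mij: "M $$ (i,j) = complex_of_real r * z" using r by (simp add: z_def)
  have z: "z * cnj z = 1"
    unfolding complex_norm_square[symmetric] using r by (simp add: z_def norm_divide r_def)
  define a where "a = Re (M $$ (i,i))"
  define b where "b = Re (M $$ (j,j))"
  \<comment> \<open>The eigenvalues of that block are (a + b) / 2 + R and (a + b) / 2 - R, with
    \<open>R\<close> as below.\<close>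
  define q where "q = (a - b) / 2"
  define R where "R = sqrt (q\<^sup>2 + r\<^sup>2)"
  have R2: "R\<^sup>2 = q\<^sup>2 + r\<^sup>2" by (simp add: R_def)
  have R: "R > 0" using r by (simp add: R_def add_nonneg_pos)
  have "(q / R)\<^sup>2 + (r / R)\<^sup>2 = 1"
    using R unfolding power_divide add_divide_distrib[symmetric] R2[symmetric] by simp
  then obtain u where u: "q / R = cos u" "r / R = sin u" by (rule sincos_total_2pi)
  \<comment> \<open>Half the angle, because conjugation turns the diagonal entries by double
    angles.\<close>
  define t where "t = u / 2"
  have ct: "cos u = (cos t)\<^sup>2 - (sin t)\<^sup>2" "sin u = 2 * sin t * cos t"
    using cos_double[of t] sin_double[of t] by (simp_all add: t_def)
  have pyth: "(cos t)\<^sup>2 + (sin t)\<^sup>2 = 1" by simp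
  have alg1: "c * (c * a + s * r) + s * (c * r + s * b) =
      (a + b) / 2 * (c\<^sup>2 + s\<^sup>2) + (q * (c\<^sup>2 - s\<^sup>2) + r * (2 * s * c))" for c s
    by (simp add: q_def field_simps power2_eq_square)
  have alg2: "c * (c * b - s * r) - s * (c * r - s * a) =
      (a + b) / 2 * (c\<^sup>2 + s\<^sup>2) - (q * (c\<^sup>2 - s\<^sup>2) + r * (2 * s * c))" for c s
    by (simp add: q_def field_simps power2_eq_square)
  let ?M' = "col_rot i j z t (row_rot i j z t M)"
  have M'_other: "?M' $$ (k,k) = M $$ (k,k)" if "k < N" "k \<noteq> i" "k \<noteq> j" for k
    using that by (simp add: col_rot_def row_rot_def)
  have zr: "z * M $$ (j,i) = complex_of_real r" "cnj z * M $$ (i,j) = complex_of_real r"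
    unfolding Mji Mij using z by (simp_all add: mult.left_commute mult.commute[of "cnj z"])
  have "?M' $$ (i,i) = complex_of_real (cos t) * (complex_of_real (cos t) * M $$ (i,i) + complex_of_real (sin t) * (z * M $$ (j,i)))
      + complex_of_real (sin t) * (complex_of_real (cos t) * (cnj z * M $$ (i,j)) + complex_of_real (sin t) * (z * cnj z) * M $$ (j,j))"
    using ij by (simp add: col_rot_def row_rot_def algebra_simps)
  also have "\<dots> = complex_of_real (cos t) * (complex_of_real (cos t) * M $$ (i,i) + complex_of_real (sin t * r))
      + complex_of_real (sin t) * (complex_of_real (cos t * r) + complex_of_real (sin t) * M $$ (j,j))"
    unfolding zr z by simp
  finally have "Re (?M' $$ (i,i)) = cos t * (cos t * a + sin t * r) + sin t * (cos t * r + sin t * b)"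
    by (simp add: a_def b_def)
  also have "\<dots> = (a + b) / 2 * ((cos t)\<^sup>2 + (sin t)\<^sup>2) + (q * cos u + r * sin u)"
    unfolding ct by (rule alg1)
  also have "q * cos u + r * sin u = R"
    unfolding u[symmetric] using R R2 by (simp add: field_simps power2_eq_square)
  finally have M'i: "Re (?M' $$ (i,i)) = (a + b) / 2 + R" unfolding pyth by simp
  have "?M' $$ (j,j) = complex_of_real (cos t) * (complex_of_real (cos t) * M $$ (j,j) - complex_of_real (sin t) * (cnj z * M $$ (i,j)))
      - complex_of_real (sin t) * (complex_of_real (cos t) * (z * M $$ (j,i)) - complex_of_real (sin t) * (z * cnj z) * M $$ (i,i))"
    using ij by (simp add: col_rot_def row_rot_def algebra_simps)
  also have "\<dots> = complex_of_real (cos t) * (complex_of_real (cos t) * M $$ (j,j) - complex_of_real (sin t * r))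
      - complex_of_real (sin t) * (complex_of_real (cos t * r) - complex_of_real (sin t) * M $$ (i,i))"
    unfolding zr z by simp
  finally have "Re (?M' $$ (j,j)) = cos t * (cos t * b - sin t * r) - sin t * (cos t * r - sin t * a)"
    by (simp add: a_def b_def)
  also have "\<dots> = (a + b) / 2 * ((cos t)\<^sup>2 + (sin t)\<^sup>2) - (q * cos u + r * sin u)"
    unfolding ct by (rule alg2)
  also have "q * cos u + r * sin u = R"
    unfolding u[symmetric] using R R2 by (simp add: field_simps power2_eq_square)
  finally have M'j: "Re (?M' $$ (j,j)) = (a + b) / 2 - R" unfolding pyth by simp
  have "a\<^sup>2 + b\<^sup>2 = (a + b)\<^sup>2 / 2 + 2 * q\<^sup>2" by (simp add: q_def power2_eq_square field_simps)
  also have "\<dots> < (a + b)\<^sup>2 / 2 + 2 * R\<^sup>2" using r unfolding R2 by simp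
  also have "\<dots> = ((a + b) / 2 + R)\<^sup>2 + ((a + b) / 2 - R)\<^sup>2" by (simp add: power2_eq_square field_simps)
  finally have lt: "a\<^sup>2 + b\<^sup>2 < ((a + b) / 2 + R)\<^sup>2 + ((a + b) / 2 - R)\<^sup>2" .
  have "diag_weight (emb M) < diag_weight (emb ?M')"
    unfolding diag_weight_def sum_split_two[OF ij]
    using lt ij by (simp add: emb_apply M'_other M'i M'j a_def[symmetric] b_def[symmetric])
  then show thesis using that[OF z, of t] by (simp add: exp_ad_rotX[OF ij z MC(1)])
qed

subsection \<open>Diagonal matrices\<close>

definition dmat :: "(nat \<Rightarrow> real) \<Rightarrow> complex mat" where
  "dmat p = mat N N (\<lambda>(k,l). if k = l then complex_of_real (p k) else 0)"

definition dvec :: "(nat \<Rightarrow> real) \<Rightarrow> mspace" where "dvec p = emb (dmat p)"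

lemma dmat_carrier [simp]: "dmat p \<in> CM" by (simp add: dmat_def)

lemma dvec_apply: "apply_bcontfun (dvec p) (k,l) = (if k = l \<and> k < N then complex_of_real (p k) else 0)"
  by (simp add: dvec_def emb_apply dmat_def)

lemma dvec_cong: "(\<And>k. k < N \<Longrightarrow> p k = q k) \<Longrightarrow> dvec p = dvec q"
  by (rule mspace_eqI) (simp add: dvec_apply)

text \<open>A quarter turn acts as a signed transposition; the signs cancel since it is applied from
  both sides.\<close>

lemma swap_dvec:
  assumes ij: "i < N" "j < N" "i \<noteq> j"
  shows "app (exp ((pi / 2) *\<^sub>R ad (rotX i j 1))) (dvec p) = dvec (p \<circ> Transposition.transpose i j)"
proof -
  have "col_rot i j 1 (pi / 2) (row_rot i j 1 (pi / 2) (dmat p)) = dmat (p \<circ> Transposition.transpose i j)"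
    by (rule CM_eqI) (use ij in \<open>auto simp: col_rot_def row_rot_def dmat_def Transposition.transpose_def\<close>)
  then show ?thesis unfolding dvec_def by (subst exp_ad_rotX[OF ij]) auto
qed

text \<open>The damped qubit is the least significant bit, so its excited and ground states sit at
  odd and even positions. This is the rate of change of the populations under unit damping.\<close>

definition pair_flow :: "(nat \<Rightarrow> real) \<Rightarrow> nat \<Rightarrow> real" where
  "pair_flow p k = (if even k then p (k + 1) else - p k)"

text \<open>For c between 0 and 1, c is the fraction of each odd weight that moves to its even
  partner. A negative c is meaningful too: it runs damping backwards.\<close>

definition damp :: "real \<Rightarrow> (nat \<Rightarrow> real) \<Rightarrow> nat \<Rightarrow> real" where
  "damp c p k = p k + c * pair_flow p k"

section \<open>Products with \<open>V_a\<close> and the damping flow on diagonal matrices\<close>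

lemma V_left:
  assumes "M \<in> CM" "k < N" "l < N"
  shows "(V_a N * M) $$ (k,l) = (if even k \<and> k + 1 < N then M $$ (k + 1,l) else 0)"
proof -
  have "(V_a N * M) $$ (k,l) = (\<Sum>m<N. if m = k + 1 then (if even k then M $$ (m,l) else 0) else 0)"
    unfolding mult_index[OF V_carrier assms] using assms
    by (intro sum.cong) (auto simp: V_a_def elim: oddE)
  then show ?thesis by simp
qed

lemma V_right:
  assumes "M \<in> CM" "k < N" "l < N"
  shows "(M * V_a N) $$ (k,l) = (if odd l then M $$ (k,l - 1) else 0)"
proof -
  have "(M * V_a N) $$ (k,l) = (\<Sum>m<N. if m = l - 1 then (if odd l then M $$ (k,m) else 0) else 0)"
    unfolding mult_index[OF assms(1) V_carrier assms(2,3)] using assms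
    by (intro sum.cong) (auto simp: V_a_def)
  then show ?thesis using assms by auto
qed

lemma adjV_left:
  assumes "M \<in> CM" "k < N" "l < N"
  shows "(adj (V_a N) * M) $$ (k,l) = (if odd k then M $$ (k - 1,l) else 0)"
proof -
  have "(adj (V_a N) * M) $$ (k,l) = (\<Sum>m<N. if m = k - 1 then (if odd k then M $$ (m,l) else 0) else 0)"
    unfolding mult_index[OF adj_carrier[OF V_carrier] assms] using assms
    by (intro sum.cong) (auto simp: adj_index, auto simp: V_a_def)
  then show ?thesis using assms by auto
qed

lemma adjV_right:
  assumes "M \<in> CM" "k < N" "l < N"
  shows "(M * adj (V_a N)) $$ (k,l) = (if even l \<and> l + 1 < N then M $$ (k,l + 1) else 0)"
proof -
  have "(M * adj (V_a N)) $$ (k,l) = (\<Sum>m<N. if m = l + 1 then (if even l then M $$ (k,m) else 0) else 0)"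
    unfolding mult_index[OF assms(1) adj_carrier[OF V_carrier] assms(2,3)] using assms
    by (intro sum.cong) (auto simp: adj_index, auto simp: V_a_def split: if_splits elim: oddE)
  then show ?thesis by simp
qed

lemma even_Suc_less: "even N \<Longrightarrow> even k \<Longrightarrow> k < N \<Longrightarrow> k + 1 < N"
  by (metis Suc_eq_plus1 Suc_lessI even_Suc)

lemma damping_dvec:
  assumes ev: "even N"
  shows "app damping (dvec p) = dvec (pair_flow p)"
proof (rule mspace_eqI)
  fix k l
  have e: "app damping (dvec p) = emb (V_a N * dmat p * adj (V_a N))
      - (1/2) *\<^sub>R (emb (adj (V_a N) * (V_a N * dmat p)) + emb (dmat p * adj (V_a N) * V_a N))"
    unfolding dvec_def damping_def
    by (simp add: app_LR_emb assoc_mult_mat[of _ N N _ N _ N])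
  show "apply_bcontfun (app damping (dvec p)) (k,l) = apply_bcontfun (dvec (pair_flow p)) (k,l)"
  proof (cases "k < N \<and> l < N")
    case True
    have o: "odd m \<Longrightarrow> Suc (m - Suc 0) = m" for m :: nat by (cases m) auto
    show ?thesis unfolding e using True even_Suc_less[OF ev]
      by (simp add: emb_apply V_left V_right adjV_left adjV_right dvec_apply less_imp_diff_less del: index_mult_mat(1))
        (auto simp: dmat_def pair_flow_def o scaleR_conv_of_real)
  next
    case False
    then show ?thesis unfolding e by (auto simp: emb_apply dvec_apply)
  qed
qed

lemma dvec_add_scaleR: "dvec (\<lambda>k. p k + c * q k) = dvec p + c *\<^sub>R dvec q"
  by (rule mspace_eqI) (simp add: dvec_apply scaleR_conv_of_real)

text \<open>Applying \<open>pair_flow\<close> twice gives the negative of \<open>pair_flow\<close>,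
  so the flow stays on a line through \<open>dvec p\<close> and relaxes exponentially along
  it.\<close>

lemma exp_damping_dvec:
  assumes ev: "even N" and t: "0 \<le> t"
  shows "app (exp (t *\<^sub>R damping)) (dvec p) = dvec (damp (1 - exp (- t)) p)"
proof -
  let ?v = "dvec (pair_flow p)"
  define f where "f s = dvec p + (1 - exp (- s)) *\<^sub>R ?v" for s :: real
  have "pair_flow (pair_flow p) = (\<lambda>k. 0 + (- 1) * pair_flow p k)"
    by (auto simp: pair_flow_def)
  then have "dvec (pair_flow (pair_flow p)) = dvec (\<lambda>k. 0 + (- 1) * pair_flow p k)" by simp
  also have "\<dots> = - ?v" unfolding dvec_add_scaleR
    by (rule mspace_eqI) (simp add: dvec_apply)
  finally have vv: "dvec (pair_flow (pair_flow p)) = - ?v" .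
  have "(f has_vector_derivative app damping (f s)) (at s within {0..t})" for s
  proof -
    have "app damping (f s) = exp (- s) *\<^sub>R ?v"
      by (simp add: f_def vv damping_dvec[OF ev] algebra_simps)
    then show ?thesis unfolding f_def by (auto intro!: derivative_eq_intros)
  qed
  then have "f t = app (exp (t *\<^sub>R damping)) (f 0)" by (intro exp_ode_unique t)
  then show ?thesis unfolding damp_def[abs_def] dvec_add_scaleR by (simp add: f_def)
qed

end

lemma sum_pairs_zero:
  fixes p :: "nat \<Rightarrow> real"
  shows "(\<Sum>k<2 * m. if even k then p (k + 1) else - p k) = 0"
  by (induction m) auto

locale qubit_system = control_system +
  assumes even_N: "even N" and N_pos: "0 < N"
begin

subsection \<open>Transfer between diagonal states\<close>

definition distr :: "(nat \<Rightarrow> real) \<Rightarrow> bool" where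
  "distr p \<longleftrightarrow> (\<forall>k<N. 0 \<le> p k) \<and> (\<Sum>k<N. p k) = 1"

definition supp :: "(nat \<Rightarrow> real) \<Rightarrow> nat set" where
  "supp p = {k. k < N \<and> p k \<noteq> 0}"

lemma finite_supp [simp]: "finite (supp p)" by (simp add: supp_def)

lemma acc_swap:
  assumes "i < N" "j < N"
  shows "acc (dvec p) (dvec (p \<circ> Transposition.transpose i j))"
proof (cases "i = j")
  case True
  then show ?thesis by (simp add: acc_refl)
next
  case False
  from acc_app[OF rev_maps_S[OF exp_ad_rev_maps[OF rotX_su[OF assms False]]], of "dvec p"]
  show ?thesis using swap_dvec[OF assms False] by metis
qed

lemma acc_permute:
  assumes "\<pi> permutes {..<N}"
  shows "acc (dvec p) (dvec (p \<circ> \<pi>))"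
proof -
  have "finite {..<N}" by simp
  from this assms have "\<forall>p. acc (dvec p) (dvec (p \<circ> \<pi>))"
  proof (induction rule: permutes_rev_induct)
    case id
    then show ?case by (simp add: acc_refl)
  next
    case (swap a b \<pi>)
    show ?case
    proof
      fix p
      have "acc (dvec p) (dvec (p \<circ> \<pi>))" using swap by blast
      moreover have "acc (dvec (p \<circ> \<pi>)) (dvec (p \<circ> \<pi> \<circ> Transposition.transpose a b))"
        using swap by (intro acc_swap) auto
      ultimately show "acc (dvec p) (dvec (p \<circ> (\<pi> \<circ> Transposition.transpose a b)))"
        unfolding o_assoc by (rule acc_trans)
    qed
  qed
  then show ?thesis by blast
qed

text \<open>In time t the transferred fraction is 1 - exp (- t), so every c below 1 is attained
  exactly. Complete damping, c = 1, is only a limit: this is a genuinely asymptotic step.\<close>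

lemma acc_damp:
  assumes "0 \<le> c" "c \<le> 1"
  shows "acc (dvec p) (dvec (damp c p))"
proof -
  have lt: "acc (dvec p) (dvec (damp c p))" if c: "0 \<le> c" "c < 1" for c
  proof -
    define t where "t = - ln (1 - c)"
    have t: "0 \<le> t" "1 - exp (- t) = c" using c by (auto simp: t_def)
    have "exp (t *\<^sub>R damping) \<in> S" using damping_wedge t(1) by (simp add: wedge_def)
    from acc_app[OF this, of "dvec p"] show ?thesis
      unfolding exp_damping_dvec[OF even_N t(1)] t(2) .
  qed
  show ?thesis
  proof (cases "c < 1")
    case True
    then show ?thesis using lt assms by blast
  next
    case False
    then have c: "c = 1" using assms by simp
    have lim: "(\<lambda>k. 1 - 1 / real (Suc k)) \<longlonglongrightarrow> 1 - 0"
      using LIMSEQ_inverse_real_of_nat by (intro tendsto_intros) (simp add: divide_inverse)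
    have "(\<lambda>k. dvec p + (1 - 1 / real (Suc k)) *\<^sub>R dvec (pair_flow p)) \<longlonglongrightarrow> dvec p + (1 - 0) *\<^sub>R dvec (pair_flow p)"
      by (intro tendsto_add tendsto_scaleR lim tendsto_const)
    then have "(\<lambda>k. dvec (damp (1 - 1 / real (Suc k)) p)) \<longlonglongrightarrow> dvec (damp c p)"
      unfolding damp_def[abs_def] dvec_add_scaleR c by simp
    then show ?thesis
      by (rule acc_lim[rotated]) (rule lt, auto simp: divide_simps)
  qed
qed

lemma sum_damp: "(\<Sum>k<N. damp c p k) = (\<Sum>k<N. p k)"
proof -
  obtain m where "N = 2 * m" using even_N by (elim evenE)
  then have "(\<Sum>k<N. pair_flow p k) = 0" unfolding pair_flow_def using sum_pairs_zero[of p m] by simp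
  then show ?thesis by (simp add: damp_def sum.distrib sum_distrib_left[symmetric])
qed

text \<open>Gathering the support at the front ensures that, as soon as it has two elements, both
  positions of the first pair are occupied. The permutation glues a bijection onto the support with
  one onto its complement.\<close>

lemma sort_support:
  assumes "distr p"
  obtains \<pi> where "\<pi> permutes {..<N}" "distr (p \<circ> \<pi>)" "supp (p \<circ> \<pi>) = {..<card (supp p)}"
proof -
  let ?s = "card (supp p)"
  have sub: "supp p \<subseteq> {..<N}" by (auto simp: supp_def)
  then have sN: "?s \<le> N" using card_mono[of "{..<N}" "supp p"] by simp
  obtain f where f: "bij_betw f {..<?s} (supp p)"
    using finite_same_card_bij[of "{..<?s}" "supp p"] by auto
  have "card {?s..<N} = card ({..<N} - supp p)"
    using sub by (simp add: card_Diff_subset)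
  then obtain g where g: "bij_betw g {?s..<N} ({..<N} - supp p)"
    using finite_same_card_bij[of "{?s..<N}" "{..<N} - supp p"] by auto
  define \<pi> where "\<pi> k = (if k < N then (if k < ?s then f k else g k) else k)" for k
  have "bij_betw \<pi> {..<?s} (supp p)"
    using f sN by (subst bij_betw_cong[where g = f]) (auto simp: \<pi>_def)
  moreover have "bij_betw \<pi> {?s..<N} ({..<N} - supp p)"
    using g by (subst bij_betw_cong[where g = g]) (auto simp: \<pi>_def)
  ultimately have "bij_betw \<pi> ({..<?s} \<union> {?s..<N}) (supp p \<union> ({..<N} - supp p))"
    by (rule bij_betw_combine) auto
  moreover have "{..<?s} \<union> {?s..<N} = {..<N}" "supp p \<union> ({..<N} - supp p) = {..<N}"
    using sub sN by auto
  ultimately have "bij_betw \<pi> {..<N} {..<N}" by simp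
  then have perm: "\<pi> permutes {..<N}"
    by (rule bij_imp_permutes) (simp add: \<pi>_def)
  have lt: "\<pi> k < N" if "k < N" for k using permutes_in_image[OF perm, of k] that by simp
  have "(\<Sum>k<N. p (\<pi> k)) = (\<Sum>k<N. p k)"
    by (rule sum.permute[OF perm, of p, unfolded o_def, symmetric])
  then have "distr (p \<circ> \<pi>)" using assms lt by (simp add: distr_def)
  moreover have "supp (p \<circ> \<pi>) = {..<?s}"
  proof -
    have f': "p (f k) \<noteq> 0" if "k < ?s" for k
      using bij_betwE[OF f] that unfolding supp_def by simp
    have g': "p (g k) = 0" if "?s \<le> k" "k < N" for k
      using bij_betwE[OF g] that unfolding supp_def by simp
    have "k \<in> supp (p \<circ> \<pi>) \<longleftrightarrow> k < ?s" for k
    proof (cases "k < ?s")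
      case True
      then have "k < N" using sN by simp
      then show ?thesis using True f'[OF True] by (simp add: supp_def[of "p \<circ> \<pi>"] \<pi>_def)
    next
      case False
      then show ?thesis using g'[of k] by (auto simp: supp_def[of "p \<circ> \<pi>"] \<pi>_def)
    qed
    then show ?thesis by auto
  qed
  ultimately show thesis by (rule that[OF perm])
qed

abbreviation e0 :: "nat \<Rightarrow> real" where "e0 \<equiv> \<lambda>k. if k = 0 then 1 else 0"

lemma card_supp_cases:
  assumes "distr q" "supp q = {..<s}"
  shows "(s = 1 \<and> dvec q = dvec e0) \<or> 2 \<le> s"
proof -
  have "s \<noteq> 0"
  proof
    assume "s = 0"
    then have "q k = 0" if "k < N" for k using assms(2) that by (auto simp: supp_def)
    then show False using assms(1) by (simp add: distr_def)
  qed
  moreover have "dvec q = dvec e0" if "s = 1"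
  proof (rule dvec_cong)
    have z: "q k = 0" if "k < N" "k \<noteq> 0" for k
    proof -
      have "k \<notin> supp q" using assms(2) \<open>s = 1\<close> that by simp
      then show ?thesis using that by (simp add: supp_def)
    qed
    have "(\<Sum>k<N. q k) = (\<Sum>k<N. if k = 0 then q 0 else 0)"
      by (rule sum.cong) (auto simp: z)
    then have "q 0 = 1" using assms(1) N_pos by (simp add: distr_def)
    then show "q k = e0 k" if "k < N" for k using z that by simp
  qed
  ultimately show ?thesis by linarith
qed

text \<open>Complete damping merges the two entries of each pair, so it shrinks a support that occupies
  both positions of the first pair.\<close>
lemma acc_e0:
  assumes "distr p" shows "acc (dvec p) (dvec e0)"
  using assms
proof (induction "card (supp p)" arbitrary: p rule: less_induct)
  case less
  let ?s = "card (supp p)"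
  obtain \<pi> where \<pi>: "\<pi> permutes {..<N}" "distr (p \<circ> \<pi>)" "supp (p \<circ> \<pi>) = {..<?s}"
    using less.prems by (rule sort_support)
  let ?q = "p \<circ> \<pi>"
  have pq: "acc (dvec p) (dvec ?q)" by (rule acc_permute[OF \<pi>(1)])
  show ?case
  proof (cases "2 \<le> ?s")
    case False
    then have "dvec ?q = dvec e0" using card_supp_cases[OF \<pi>(2,3)] by auto
    then show ?thesis using pq by simp
  next
    case True
    let ?r = "damp 1 ?q"
    have r: "?r k = (if even k then ?q k + ?q (k + 1) else 0)" for k
      by (simp add: damp_def pair_flow_def)
    have nn: "0 \<le> ?q k" if "k < N" for k using \<pi>(2) that by (simp add: distr_def)
    have "0 \<le> ?r k" if "k < N" for k
      unfolding r using nn[of k] nn[of "k + 1"] that even_Suc_less[OF even_N _ that] by auto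
    then have "distr ?r" using \<pi>(2) by (simp add: distr_def sum_damp)
    have nz: "?q k = 0" if "k < N" "?s \<le> k" for k
    proof -
      have "k \<notin> supp ?q" using \<pi>(3) that by simp
      then show ?thesis using that by (simp add: supp_def)
    qed
    \<comment> \<open>Position 1 is odd and was occupied. No even position beyond the support gains
      weight, because its partner lies beyond it as well.\<close>
    have "supp ?r \<subseteq> {..<?s} - {1}"
    proof
      fix k assume "k \<in> supp ?r"
      then have k: "k < N" "even k" "?q k + ?q (k + 1) \<noteq> 0"
        unfolding supp_def mem_Collect_eq r by (auto split: if_splits)
      have "k < ?s"
        using nz[OF k(1)] nz[OF even_Suc_less[OF even_N k(2,1)]] k(3) by (cases "k < ?s") auto
      then show "k \<in> {..<?s} - {1}" using k(2) by auto
    qed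
    then have "card (supp ?r) \<le> card ({..<?s} - {1})" by (intro card_mono) auto
    also have "\<dots> < ?s" using True by simp
    finally have "acc (dvec ?r) (dvec e0)" using less.hyps \<open>distr ?r\<close> by blast
    moreover have "acc (dvec ?q) (dvec ?r)" by (rule acc_damp) auto
    ultimately show ?thesis using pq acc_trans by blast
  qed
qed

text \<open>Running the damping backwards from \<open>p\<close> until the first entry vanishes gives a
  distribution with smaller support, from which \<open>p\<close> is reached by damping.\<close>
lemma acc_from_e0:
  assumes "distr p" shows "acc (dvec e0) (dvec p)"
  using assms
proof (induction "card (supp p)" arbitrary: p rule: less_induct)
  case less
  let ?s = "card (supp p)"
  obtain \<pi> where \<pi>: "\<pi> permutes {..<N}" "distr (p \<circ> \<pi>)" "supp (p \<circ> \<pi>) = {..<?s}"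
    using less.prems by (rule sort_support)
  define q where "q = p \<circ> \<pi>"
  have q: "distr q" "supp q = {..<?s}" using \<pi> by (simp_all add: q_def)
  have "p = q \<circ> Hilbert_Choice.inv \<pi>" using permutes_inv_o(1)[OF \<pi>(1)] by (simp add: q_def o_assoc[symmetric])
  then have qp: "acc (dvec q) (dvec p)" using acc_permute[OF permutes_inv[OF \<pi>(1)], of q] by simp
  show ?case
  proof (cases "2 \<le> ?s")
    case False
    then have "dvec q = dvec e0" using card_supp_cases[OF q] by auto
    then show ?thesis using qp by simp
  next
    case True
    have sN: "?s \<le> N" using card_mono[of "{..<N}" "supp p"] by (auto simp: supp_def)
    have pos: "0 < q k" if "k < ?s" for k
    proof -
      have "k \<in> supp q" using q(2) that by simp
      then show ?thesis using q(1) by (auto simp: supp_def distr_def less_le)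
    qed
    have nz: "q k = 0" if "k < N" "?s \<le> k" for k
    proof -
      have "k \<notin> supp q" using q(2) that by simp
      then show ?thesis using that by (simp add: supp_def)
    qed
    have nn: "0 \<le> q k" if "k < N" for k using q(1) that by (simp add: distr_def)
    \<comment> \<open>The even positions of the fully occupied pairs.\<close>
    define I where "I = {k. even k \<and> k + 1 < ?s}"
    have fI: "finite I" by (rule finite_subset[of _ "{..<?s}"]) (auto simp: I_def)
    have "0 \<in> I" using True by (simp add: I_def)
    then have neI: "(\<lambda>k. q k / q (k + 1)) ` I \<noteq> {}" by blast
    \<comment> \<open>Backward damping takes \<open>x * q (k + 1)\<close> from an even entry, so the
      minimal ratio is the largest x that keeps all entries nonnegative; the minimizing pair loses
      its even entry.\<close>
    define x where "x = Min ((\<lambda>k. q k / q (k + 1)) ` I)"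
    have "x \<in> (\<lambda>k. q k / q (k + 1)) ` I" unfolding x_def by (rule Min_in) (use fI neI in auto)
    then obtain k0 where k0: "k0 \<in> I" "x = q k0 / q (k0 + 1)" by blast
    have x_le: "x \<le> q k / q (k + 1)" if "k \<in> I" for k
      unfolding x_def by (rule Min_le) (use fI that in auto)
    have x_pos: "0 < x" using k0 pos[of k0] pos[of "k0 + 1"] by (auto simp: I_def)
    define r where "r = damp (- x) q"
    have r: "r k = (if even k then q k - x * q (k + 1) else (1 + x) * q k)" for k
      by (simp add: r_def damp_def pair_flow_def algebra_simps)
    \<comment> \<open>If the partner of k is outside the support, nothing is taken from
      \<open>q k\<close>.\<close>
    have r_even: "0 \<le> q k - x * q (k + 1)" if k: "k < N" "even k" for k
    proof (cases "k + 1 < ?s")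
      case True
      then have "k \<in> I" using k by (simp add: I_def)
      from x_le[OF this] show ?thesis using pos[OF True] by (simp add: pos_le_divide_eq)
    next
      case False
      then show ?thesis using nz[OF even_Suc_less[OF even_N k(2,1)]] nn[OF k(1)] by simp
    qed
    have "0 \<le> r k" if "k < N" for k
      unfolding r using r_even[OF that] nn[OF that] x_pos by auto
    then have "distr r" using q(1) by (simp add: distr_def r_def sum_damp)
    \<comment> \<open>Odd entries are merely scaled by 1 + x, and an even entry outside the support
      has its partner outside too; so no position is added, while \<open>k0\<close> drops
      out.\<close>
    have "supp r \<subseteq> {..<?s} - {k0}"
    proof
      fix k assume "k \<in> supp r"
      then have k: "k < N" "r k \<noteq> 0" by (auto simp: supp_def)
      have "k < ?s"
      proof (rule ccontr)
        assume "\<not> k < ?s"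
        then have "q k = 0" "even k \<Longrightarrow> q (k + 1) = 0"
          using nz[OF k(1)] nz[OF even_Suc_less[OF even_N _ k(1)]] by auto
        then show False using k(2) by (auto simp: r split: if_splits)
      qed
      moreover have "r k0 = 0" using k0 pos[of "k0 + 1"] by (simp add: r I_def)
      ultimately show "k \<in> {..<?s} - {k0}" using k(2) by auto
    qed
    then have "card (supp r) \<le> card ({..<?s} - {k0})" by (intro card_mono) auto
    also have "\<dots> < ?s" using k0(1) True by (simp add: I_def)
    finally have e0r: "acc (dvec e0) (dvec r)" using less.hyps \<open>distr r\<close> by blast
    \<comment> \<open>Backward damping scaled the odd weights by 1 + x, so losing the fraction x /
      (1 + x) restores them and gives the even partners exactly \<open>x * q (k + 1)\<close>
      back.\<close>
    have c: "(1 + x) * (x / (1 + x)) = x" "0 \<le> x / (1 + x)" "x / (1 + x) \<le> 1" using x_pos by auto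
    define c where "c = x / (1 + x)"
    note c = c[folded c_def]
    have "damp c r k = q k" for k
    proof (cases "even k")
      case True
      have "damp c r k = q k - x * q (k + 1) + ((1 + x) * c) * q (k + 1)"
        using True by (simp add: damp_def pair_flow_def r algebra_simps)
      then show ?thesis unfolding c(1) by simp
    next
      case False
      have "damp c r k = q k + x * q k - ((1 + x) * c) * q k"
        using False by (simp add: damp_def pair_flow_def r algebra_simps)
      then show ?thesis unfolding c(1) by simp
    qed
    then have "acc (dvec r) (dvec q)" using acc_damp[OF c(2,3), of r] by (metis ext)
    then show ?thesis using e0r qp acc_trans by blast
  qed
qed

subsection \<open>Diagonalization and conclusion\<close>

lemma pos1_diagonal:
  assumes A: "A \<in> pos1 N" and off: "\<And>i j. i < N \<Longrightarrow> j < N \<Longrightarrow> i \<noteq> j \<Longrightarrow> A $$ (i,j) = 0"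
  shows "\<exists>p. distr p \<and> emb A = dvec p"
proof (intro exI conjI)
  define p where "p k = Re (A $$ (k,k))" for k
  have AC: "A \<in> CM" "adj A = A" using A by (auto simp: pos1_def hermitian_mat_def)
  have diag: "A $$ (k,k) = complex_of_real (p k)" if "k < N" for k
    using adj_index[OF AC(1) that that] AC(2) by (simp add: p_def complex_eq_iff)
  have "0 \<le> p k" if "k < N" for k
  proof -
    let ?v = "\<lambda>i. if i = k then 1 else (0::complex)"
    have "sform A ?v ?v = (\<Sum>i<N. if i = k then (\<Sum>j<N. if j = k then A $$ (i,j) else 0) else 0)"
      unfolding sform_def by (intro sum.cong refl) (auto simp: if_distrib[of "\<lambda>z. _ * z"] cong: if_cong)
    also have "\<dots> = A $$ (k,k)" using that by simp
    finally have "sform A ?v ?v = A $$ (k,k)" .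
    moreover have "0 \<le> Re (sform A ?v ?v)" using A unfolding pos1_iff psd_def by blast
    ultimately show ?thesis by (simp add: p_def)
  qed
  moreover have "complex_of_real (\<Sum>k<N. p k) = 1"
  proof -
    have "mtrace A = (\<Sum>k<N. complex_of_real (p k))"
      unfolding mtrace_def using AC(1) by (intro sum.cong) (auto simp: diag)
    then show ?thesis using A by (simp add: pos1_def)
  qed
  ultimately show "distr p" unfolding distr_def using of_real_eq_1_iff by blast
  show "emb A = dvec p"
    by (rule mspace_eqI) (auto simp: emb_apply dvec_apply diag off)
qed

text \<open>A Jacobi rotation keeps the maximizer inside the orbit, so a nonzero off-diagonal entry
  would contradict maximality. The maximizer is only a limit of orbit points;
  \<open>orbit_acc\<close> and \<open>orbit_acc_back\<close> make it accessible in both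
  directions.\<close>

lemma diagonalize:
  assumes A: "A \<in> pos1 N"
  shows "\<exists>p. distr p \<and> acc (emb A) (dvec p) \<and> acc (dvec p) (emb A)"
proof -
  have "app 1 (emb A) \<in> orbit (emb A)"
    unfolding orbit_def by (rule subsetD[OF closure_subset imageI[OF rev_maps_one]])
  then have ne: "orbit (emb A) \<noteq> {}" by blast
  have "continuous_on (orbit (emb A)) diag_weight"
    unfolding diag_weight_def
    by (intro continuous_intros linear_continuous_on bounded_linear_compose[OF bounded_linear_Re bounded_linear_apply_mspace])
  from continuous_attains_sup[OF compact_orbit[OF A] ne this]
  obtain y where y: "y \<in> orbit (emb A)" and max: "\<And>w. w \<in> orbit (emb A) \<Longrightarrow> diag_weight w \<le> diag_weight y"
    by blast
  obtain B where B: "B \<in> pos1 N" "y = emb B" using orbit_pos1[OF A y] by blast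
  have herm: "hermitian_mat N B" using B(1) by (simp add: pos1_def)
  have "B $$ (i,j) = 0" if ij: "i < N" "j < N" "i \<noteq> j" for i j
  proof (rule ccontr)
    assume nz: "B $$ (i,j) \<noteq> 0"
    obtain t z where tz: "z * cnj z = 1"
      "diag_weight (emb B) < diag_weight (app (exp (t *\<^sub>R ad (rotX i j z))) (emb B))"
      by (rule jacobi_increase[OF ij herm nz])
    have "app (exp (t *\<^sub>R ad (rotX i j z))) (emb B) \<in> orbit (emb A)"
      using orbit_invariant[OF exp_ad_rev_maps[OF rotX_su[OF ij]] y] B(2) by simp
    from max[OF this] show False using tz(2) B(2) by simp
  qed
  then obtain p where p: "distr p" "emb B = dvec p" using pos1_diagonal[OF B(1)] by blast
  have "acc y (emb A)"
    by (rule orbit_acc_back[OF y]) (simp_all add: B app_proj_emb pos1_carrier A)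
  then show ?thesis using orbit_acc[OF y] p B(2) by metis
qed

lemma acc_pos1:
  assumes "A \<in> pos1 N" "B \<in> pos1 N"
  shows "acc (emb A) (emb B)"
proof -
  obtain p where p: "distr p" "acc (emb A) (dvec p)" using diagonalize[OF assms(1)] by blast
  obtain q where q: "distr q" "acc (dvec q) (emb B)" using diagonalize[OF assms(2)] by blast
  show ?thesis using p(2) acc_e0[OF p(1)] acc_from_e0[OF q(1)] q(2) acc_trans by blast
qed

lemma closure_reach:
  assumes "A \<in> pos1 N"
  shows "mat_closure N (reach N H0 Hs gs A) = pos1 N"
proof
  show "mat_closure N (reach N H0 Hs gs A) \<subseteq> pos1 N"
    by (rule mat_closure_pos1[OF reach_pos1[OF H0 Hs gs assms]])
  show "pos1 N \<subseteq> mat_closure N (reach N H0 Hs gs A)"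
    using acc_mat_closure[OF pos1_carrier[OF assms] pos1_carrier acc_pos1[OF assms]] by blast
qed

end

theorem theorem1:
  fixes n N :: nat and H0 :: "complex mat" and Hs :: "complex mat list" and \<gamma>s :: real
  assumes "n \<ge> 1" and "N = 2 ^ n"
    and "hermitian_mat N H0" and "\<forall>H\<in>set Hs. hermitian_mat N H"
    and "\<gamma>s > 0"
    and "lie_gen ((\<lambda>H. \<i> \<cdot>\<^sub>m H) ` (set (H0 # Hs))) = su N"
  shows "\<forall>\<rho>0 \<in> pos1 N. mat_closure N (reach N H0 Hs \<gamma>s \<rho>0) = pos1 N"
proof -
  \<comment> \<open>The condition on n makes 2 ^ n even, so that basis states come in complete
    pairs.\<close>
  interpret qubit_system N H0 Hs \<gamma>s
    by unfold_locales (use assms in auto)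
  show ?thesis using closure_reach by blast
qed

end
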